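(* Let $L$ be a (nonempty) artinian lattice and $X:K^+(L)\to\mathbb{R}_{>0}$ a semigroup homomorphism. Then there exists a unique paracomplemented $\mathbb{R}$-filtration $a\in\mathcal B(L)$ such that the polarized lattice $(\Lambda(a),Z)$, where $$Z([x,y])=\sum_{\lambda\in\mathrm{supp}(a)}(1+\lambda i)\,X([x_\lambda,y_\lambda])\qquad (x\le y \text{ in }\Lambda(a)),$$ is semistable with phase $\phi(\Lambda(a))=0$.
   Context: Lattices. A lattice is a partially ordered set in which any two elements $a,b$ have a join $a\vee b$ and a meet $a\wedge b$. For $a\le b$ put $[a,b]=\{x: a\le x\le b\}$. A lattice is modular if $a\le b$ implies $(x\wedge b)\vee a=(x\vee a)\wedge b$ for all $x$. It has finite length if there is an upper bound on the length $n$ of chains $a_0<a_1<\dots<a_n$. An artinian lattice is a modular lattice of finite length; if nonempty it has a least element $0$ and a greatest element $1$. A lattice with $0,1$ is complemented if every $a$ has a complement, i.e. an element $b$ with $a\wedge b=0$, $a\vee b=1$. For $c\le a\le d$, "$a$ has a complement in $[c,d]$" means there is $b\in[c,d]$ with $a\wedge b=c$, $a\vee b=d$. $K(L)$ is the abelian group with generators $\overline{[a,b]}$ ($a\le b$) and relations $\overline{[a,b]}+\overline{[b,c]}=\overline{[a,c]}$ and $\overline{[a,a\vee b]}=\overline{[a\wedge b,b]}$. $K^+(L)\subset K(L)$ is the sub-semigroup generated by the $\overline{[a,b]}$ with $a<b$. One writes $X([a,b])$ for $X(\overline{[a,b]})$, with $X([a,a])=0$. $\mathbb{R}$-filtrations.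 An $\mathbb{R}$-filtration in $L$ is a pair of increasing functions $a_\pm:\mathbb{R}\to L$ for which there are reals $\lambda_1<\dots<\lambda_n$ and a chain $0=a_0<a_1<\dots<a_n=1$ in $L$ with $a_+(\lambda)=a_k$, $k=\#\{j:\lambda_j\le\lambda\}$, and $a_-(\lambda)=a_k$, $k=\#\{j:\lambda_j<\lambda\}$. Its support is $\mathrm{supp}(a)=\{\lambda: a_+(\lambda)\ne a_-(\lambda)\}=\{\lambda_1,\dots,\lambda_n\}$. It is paracomplemented if all intervals $[a_+(\lambda),a_+(\lambda+1)]$, $\lambda\in\mathbb{R}$, are complemented lattices. $\mathcal B(L)$ is the set of paracomplemented $\mathbb{R}$-filtrations in $L$. For $a\in\mathcal B(L)$, $\Lambda(a)$ is the set of families $x=(x_\lambda)_{\lambda\in\mathbb{R}}$ with $x_\lambda\in[a_-(\lambda),a_+(\lambda)]$ such that for every $\lambda\in\mathbb{R}$ the element $a_+(\lambda)$ has a complement in $[x_\lambda,x_{\lambda+1}]$. With the componentwise order it is a sublattice of $\prod_\lambda[a_-(\lambda),a_+(\lambda)]$ and an artinian lattice. Semistability. For $x<y$ in $\Lambda(a)$ the number $Z([x,y])$ has positive real part, and its phase is $\phi([x,y])=\mathrm{Arg}\,Z([x,y])\in(-\pi/2,\pi/2)$; $\phi(\Lambda(a))=\phi([0,1])$. The polarized lattice $\Lambda(a)$ is semistable if $\phi([0,x])\le\phi(\Lambda(a))$ for all $x\ne 0,1$ in $\Lambda(a)$. If $L$ has one element (so the only $\mathbb{R}$-filtration has empty support)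 the condition "semistable with phase $0$" is regarded as vacuously satisfied. *)

theory Defs
  imports "HOL-Analysis.Analysis" "HOL-Algebra.Free_Abelian_Groups"
begin

class artinian_lattice = Lattices.lattice +
  assumes modular: "a \<le> b \<Longrightarrow> sup (inf x b) a = inf (sup x a) b"
    and finite_length: "\<exists>N::nat. \<forall>n c. (\<forall>i<n. c i < c (Suc i)) \<longrightarrow> n \<le> N"

subsection \<open>Complements in intervals\<close>

definition has_complement_in :: "'a::lattice \<Rightarrow> 'a \<Rightarrow> 'a \<Rightarrow> bool" where
  "has_complement_in c d a \<longleftrightarrow> (\<exists>b\<in>{c..d}. inf a b = c \<and> sup a b = d)"

definition complemented_interval :: "'a::lattice \<Rightarrow> 'a \<Rightarrow> bool" where
  "complemented_interval c d \<longleftrightarrow> (\<forall>a\<in>{c..d}. has_complement_in c d a)"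

subsection \<open>The group \<open>K(L)\<close> and the semigroup \<open>K\<^sup>+(L)\<close>\<close>

text \<open>The interval \<open>[a,b]\<close> is represented by the pair \<open>(a,b)\<close> of its endpoints.\<close>

definition intervals :: "('a::lattice \<times> 'a) set" where
  "intervals = {(a, b). a \<le> b}"

definition K_relators :: "(('a::lattice \<times> 'a) \<Rightarrow>\<^sub>0 int) set" where
  "K_relators =
     {frag_of (a, b) + frag_of (b, c) - frag_of (a, c) | a b c. a \<le> b \<and> b \<le> c} \<union>
     {frag_of (a, sup a b) - frag_of (inf a b, b) | a b. True}"

definition K_subgroup :: "(('a::lattice \<times> 'a) \<Rightarrow>\<^sub>0 int) set" where
  "K_subgroup = generate (free_Abelian_group intervals) K_relators"

definition K_group :: "(('a::lattice \<times> 'a) \<Rightarrow>\<^sub>0 int) set monoid" where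
  "K_group = free_Abelian_group intervals Mod K_subgroup"

definition K_gen :: "'a::lattice \<Rightarrow> 'a \<Rightarrow> (('a \<times> 'a) \<Rightarrow>\<^sub>0 int) set" where
  "K_gen a b = K_subgroup #>\<^bsub>free_Abelian_group intervals\<^esub> frag_of (a, b)"

inductive_set K_plus :: "(('a::lattice \<times> 'a) \<Rightarrow>\<^sub>0 int) set set" where
  gen: "a < b \<Longrightarrow> K_gen a b \<in> K_plus"
| mult: "u \<in> K_plus \<Longrightarrow> v \<in> K_plus \<Longrightarrow> u \<otimes>\<^bsub>K_group\<^esub> v \<in> K_plus"

definition positive_hom :: "((('a::lattice \<times> 'a) \<Rightarrow>\<^sub>0 int) set \<Rightarrow> real) \<Rightarrow> bool" where
  "positive_hom X \<longleftrightarrow>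
     (\<forall>u\<in>K_plus. X u > 0) \<and>
     (\<forall>u\<in>K_plus. \<forall>v\<in>K_plus. X (u \<otimes>\<^bsub>K_group\<^esub> v) = X u + X v)"

text \<open>\<open>K_plus\<close> does not contain the zero class of \<open>[a,a]\<close>, so the convention
  \<open>X([a,a]) = 0\<close> has to be imposed separately.\<close>

definition on_interval :: "((('a::lattice \<times> 'a) \<Rightarrow>\<^sub>0 int) set \<Rightarrow> real) \<Rightarrow> 'a \<Rightarrow> 'a \<Rightarrow> real" where
  "on_interval X a b = (if a = b then 0 else X (K_gen a b))"

subsection \<open>Real filtrations\<close>

text \<open>A filtration is represented by the pair \<open>(a\<^sub>-, a\<^sub>+)\<close>.\<close>

type_synonym 'a filtration = "(real \<Rightarrow> 'a) \<times> (real \<Rightarrow> 'a)"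

abbreviation fminus :: "'a filtration \<Rightarrow> real \<Rightarrow> 'a" where
  "fminus a \<equiv> fst a"

abbreviation fplus :: "'a filtration \<Rightarrow> real \<Rightarrow> 'a" where
  "fplus a \<equiv> snd a"

definition R_filtration :: "'a::lattice filtration \<Rightarrow> bool" where
  "R_filtration a \<longleftrightarrow> mono (fminus a) \<and> mono (fplus a) \<and>
     (\<exists>(n::nat) (l::nat \<Rightarrow> real) (c::nat \<Rightarrow> 'a).
        strict_mono_on {1..n} l \<and> strict_mono_on {0..n} c \<and>
        (\<forall>x. c 0 \<le> x) \<and> (\<forall>x. x \<le> c n) \<and>
        (\<forall>t. fplus a t = c (card {j\<in>{1..n}. l j \<le> t})) \<and>
        (\<forall>t. fminus a t = c (card {j\<in>{1..n}. l j < t})))"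

definition supp :: "'a filtration \<Rightarrow> real set" where
  "supp a = {t. fplus a t \<noteq> fminus a t}"

definition paracomplemented :: "'a::lattice filtration \<Rightarrow> bool" where
  "paracomplemented a \<longleftrightarrow> (\<forall>t. complemented_interval (fplus a t) (fplus a (t + 1)))"

definition B_filtrations :: "'a::lattice filtration set" where
  "B_filtrations = {a. R_filtration a \<and> paracomplemented a}"

text \<open>The order on \<open>Lambda a\<close> is the componentwise order of the function space.\<close>

definition Lambda :: "'a::lattice filtration \<Rightarrow> (real \<Rightarrow> 'a) set" where
  "Lambda a = {x. \<forall>t. x t \<in> {fminus a t..fplus a t} \<and>
                      has_complement_in (x t) (x (t + 1)) (fplus a t)}"

definition Z_Lambda ::
  "((('a::lattice \<times> 'a) \<Rightarrow>\<^sub>0 int) set \<Rightarrow> real) \<Rightarrow> 'a filtration \<Rightarrow>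
     (real \<Rightarrow> 'a) \<Rightarrow> (real \<Rightarrow> 'a) \<Rightarrow> complex" where
  "Z_Lambda X a x y =
     (\<Sum>t\<in>supp a. (1 + of_real t * \<i>) * of_real (on_interval X (x t) (y t)))"

subsection \<open>Semistability\<close>

text \<open>Here \<open>S\<close> is a lattice with least and greatest elements, given as a subset of an
  ordered type, and \<open>Z x y\<close> is the value of the polarization at the interval \<open>[x,y]\<close>.
  If \<open>S\<close> has a single element then \<open>Z\<close> vanishes, the phase is \<open>0\<close> because
  \<open>Arg 0 = 0\<close>, and semistability is vacuous.\<close>

definition lattice_phase :: "'b::order set \<Rightarrow> ('b \<Rightarrow> 'b \<Rightarrow> complex) \<Rightarrow> real" where
  "lattice_phase S Z = Arg (Z (LEAST x. x \<in> S) (GREATEST x. x \<in> S))"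

definition semistable :: "'b::order set \<Rightarrow> ('b \<Rightarrow> 'b \<Rightarrow> complex) \<Rightarrow> bool" where
  "semistable S Z \<longleftrightarrow>
     (\<forall>x\<in>S. x \<noteq> (LEAST x. x \<in> S) \<longrightarrow> x \<noteq> (GREATEST x. x \<in> S) \<longrightarrow>
        Arg (Z (LEAST x. x \<in> S) x) \<le> lattice_phase S Z)"

end

(*
  An order-theoretic variational argument. A homomorphism X is the same thing as a strictly
  monotone modular function v on L. For existence, minimise the energy, i.e. the sum of t^2 times
  the X-size of the jump at t, over all paracomplemented filtrations. The minimum is attained,
  because v takes only finitely many values (each chain therefore contributes one of finitely many
  convex minimisation problems in its weights) and the paracomplementedness of a weighted chain is
  a closed condition on the weights. An element x of Lambda a is exactly a direction in which a can
  be deformed, by lowering the weight of the part x a little; the first-order condition for a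
  minimum in these directions, together with translations, is semistability with phase 0.

  For uniqueness, two such filtrations a and b have a common bigraded refinement. The filtration b
  induces for each d an element of Lambda a, the part of a where the b-weight exceeds the a-weight
  by at most d. Summing the semistability inequalities over d gives that the sum of s (t - s) over
  the refinement, s and t being the weights in a and in b, is nonnegative. Adding the same
  inequality with a and b exchanged shows that -(s - t)^2 has nonnegative sum, so s = t throughout.
*)
theory Submission
  imports Defs
begin

section \<open>Modular lattices of finite length\<close>

lemma modular_sup_inf:
  fixes a b x :: "'a::artinian_lattice"
  assumes "a \<le> b"
  shows "inf (sup a x) b = sup a (inf x b)" "inf b (sup a x) = sup a (inf b x)"
  using modular[OF assms, of x] by (simp_all add: sup_commute inf_commute)

lemma has_complement_inI:
  assumes "c \<le> a" "inf a b = c" "sup a b = d"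
  shows "has_complement_in c d a"
  unfolding has_complement_in_def using assms by (metis atLeastAtMost_iff inf_le2 sup_ge2)

lemma has_complement_inE:
  assumes "has_complement_in c d a"
  obtains b where "c \<le> b" "b \<le> d" "inf a b = c" "sup a b = d" "inf b a = c" "sup b a = d"
proof -
  from assms obtain b where b: "b \<in> {c..d}" "inf a b = c" "sup a b = d"
    unfolding has_complement_in_def by blast
  show ?thesis
    by (rule that[of b]) (use b in \<open>simp_all add: inf_commute sup_commute\<close>)
qed

lemma complemented_intervalD:
  "complemented_interval c d \<Longrightarrow> c \<le> a \<Longrightarrow> a \<le> d \<Longrightarrow> has_complement_in c d a"
  unfolding complemented_interval_def by auto

lemma complemented_interval_refl [simp]: "complemented_interval c c"
  unfolding complemented_interval_def has_complement_in_def by auto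

text \<open>Modularity lets a complement \<open>b\<close> in \<open>[c, d]\<close> be pushed into
  the subinterval: it is joined with \<open>p\<close> and the result is cut by
  \<open>q\<close>.\<close>

lemma complemented_subinterval:
  fixes c d p q :: "'a::artinian_lattice"
  assumes "complemented_interval c d" "c \<le> p" "q \<le> d"
  shows "complemented_interval p q"
  unfolding complemented_interval_def
proof
  fix z assume z: "z \<in> {p..q}"
  then obtain b where b: "inf z b = c" "sup z b = d"
    using complemented_intervalD[OF assms(1), of z] assms
    by (meson atLeastAtMost_iff has_complement_inE order_trans)
  show "has_complement_in p q z"
  proof (rule has_complement_inI)
    have "inf z (inf (sup p b) q) = inf z (sup p b)"
      using z by (metis atLeastAtMost_iff inf.absorb1 inf_assoc inf_commute)
    also have "\<dots> = sup p (inf z b)"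
      using z by (simp add: modular_sup_inf)
    finally show "inf z (inf (sup p b) q) = p"
      using b assms by (simp add: sup_absorb1)
    have "sup z (inf (sup p b) q) = inf (sup z (sup p b)) q"
      using z by (simp add: modular_sup_inf)
    also have "sup z (sup p b) = d"
      using z b by (metis atLeastAtMost_iff sup.absorb1 sup_assoc)
    finally show "sup z (inf (sup p b) q) = q"
      using assms by (simp add: inf_absorb2)
  qed (use z in auto)
qed

text \<open>A split extension of semisimple pieces is semisimple. For \<open>z\<close>, the trace
  \<open>inf z m\<close> is complemented below \<open>m\<close> and \<open>sup m z\<close> is
  complemented above \<open>m\<close>; the second complement is moved into the complement
  \<open>m'\<close> of \<open>m\<close>, and the join of the two is a complement of
  \<open>z\<close>.\<close>

lemma complemented_interval_glue:
  fixes p m q :: "'a::artinian_lattice"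
  assumes pm: "complemented_interval p m" and mq: "complemented_interval m q"
    and m: "has_complement_in p q m" "p \<le> m" "m \<le> q"
  shows "complemented_interval p q"
  unfolding complemented_interval_def
proof
  fix z assume z: "z \<in> {p..q}"
  obtain m' where m': "inf m m' = p" "sup m m' = q" "p \<le> m'"
    using m(1) by (rule has_complement_inE)
  obtain u where u: "inf (inf z m) u = p" "sup (inf z m) u = m" "p \<le> u" "u \<le> m"
    using complemented_intervalD[OF pm, of "inf z m"] z m
    by (auto elim!: has_complement_inE)
  obtain w where w: "inf (sup m z) w = m" "sup (sup m z) w = q" "m \<le> w" "w \<le> q"
    using complemented_intervalD[OF mq, of "sup m z"] z m
    by (auto elim!: has_complement_inE)
  \<comment> \<open>\<open>inf w m'\<close> is the copy of \<open>w\<close> inside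
    \<open>m'\<close>; joining with \<open>m\<close> recovers \<open>w\<close>.\<close>
  have wm: "sup m (inf w m') = w"
    using modular_sup_inf(2)[OF w(3), of m'] m' w by (simp add: inf_absorb1)
  show "has_complement_in p q z"
  proof (rule has_complement_inI)
    have "sup z u = sup z (sup (inf z m) u)"
      by (simp add: sup_assoc[symmetric] sup_absorb1)
    also have "\<dots> = sup m z"
      using u by (simp add: sup_commute)
    finally have "sup z (sup u (inf w m')) = sup (sup m z) (inf w m')"
      by (simp add: sup_assoc[symmetric])
    also have "\<dots> = sup (sup m z) (sup m (inf w m'))"
      by (simp add: sup_aci)
    also have "\<dots> = q"
      using wm w by simp
    finally show "sup z (sup u (inf w m')) = q" .
    have "sup u (inf w m') \<le> w"
      using u w by (auto intro: order_trans)
    then have "inf z (sup u (inf w m')) \<le> m"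
      using w(1) by (metis inf_mono sup_ge2)
    then have "inf z (sup u (inf w m')) = inf z (inf m (sup u (inf w m')))"
      by (metis inf.absorb2 inf_assoc inf_commute)
    also have "inf m (sup u (inf w m')) = sup u (inf m (inf w m'))"
      using u by (simp add: modular_sup_inf)
    also have "inf m (inf w m') = p"
      using m' w by (metis inf.absorb1 inf_assoc)
    also have "inf z (sup u p) = p"
      using u z m by (metis atLeastAtMost_iff inf.absorb2 inf_assoc sup.absorb1)
    finally show "inf z (sup u (inf w m')) = p" .
  qed (use z in auto)
qed

section \<open>Chain conditions, bounds and composition series\<close>

lemma wf_less_artinian: "wf {(x::'a::artinian_lattice, y). x < y}"
proof -
  obtain N where N: "\<And>n c::nat \<Rightarrow> 'a. (\<And>i. i < n \<Longrightarrow> c i < c (Suc i)) \<Longrightarrow> n \<le> N"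
    using finite_length by metis
  have False if "\<forall>i. (f (Suc i), f i) \<in> {(x::'a, y). x < y}" for f
  proof -
    \<comment> \<open>The descending sequence is read backwards from \<open>f (Suc N)\<close>, since
      the length bound concerns ascending chains.\<close>
    have "f (Suc N - i) < f (Suc N - Suc i)" if "i < Suc N" for i
      using \<open>\<forall>i. (f (Suc i), f i) \<in> _\<close>[rule_format, of "N - i"] that
      by (simp add: Suc_diff_le)
    from N[of "Suc N" "\<lambda>i. f (Suc N - i)", OF this] show False by simp
  qed
  then show ?thesis
    unfolding wf_iff_no_infinite_down_chain by blast
qed

lemma wf_greater_artinian: "wf {(x::'a::artinian_lattice, y). y < x}"
proof -
  obtain N where N: "\<And>n c::nat \<Rightarrow> 'a. (\<And>i. i < n \<Longrightarrow> c i < c (Suc i)) \<Longrightarrow> n \<le> N"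
    using finite_length by metis
  have False if "\<forall>i. (f (Suc i), f i) \<in> {(x::'a, y). y < x}" for f
    using N[of "Suc N" f] that by auto
  then show ?thesis
    unfolding wf_iff_no_infinite_down_chain by blast
qed

text \<open>The class fixes no constants for 0 and 1. The chosen element is the right one because
  finite length provides a minimal element, which is least since meets exist; dually for
  \<open>ltop\<close>.\<close>

definition lbot :: "'a::artinian_lattice" where
  "lbot = (SOME x. \<forall>y. x \<le> y)"

definition ltop :: "'a::artinian_lattice" where
  "ltop = (SOME x. \<forall>y. y \<le> x)"

lemma lbot_le [simp]: "lbot \<le> (x::'a::artinian_lattice)"
proof -
  obtain z :: 'a where "\<And>y. y < z \<Longrightarrow> False"
    using wfE_min[OF wf_less_artinian, of undefined UNIV] by auto
  then have "\<forall>y. z \<le> y"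
    by (metis inf_le1 inf_le2 order_le_less)
  then show ?thesis
    unfolding lbot_def by (rule someI2) simp
qed

lemma le_ltop [simp]: "(x::'a::artinian_lattice) \<le> ltop"
proof -
  obtain z :: 'a where "\<And>y. z < y \<Longrightarrow> False"
    using wfE_min[OF wf_greater_artinian, of undefined UNIV] by auto
  then have "\<forall>y. y \<le> z"
    by (metis sup_ge1 sup_ge2 order_le_less)
  then show ?thesis
    unfolding ltop_def by (rule someI2) simp
qed

lemma le_lbot_iff [simp]: "(x::'a::artinian_lattice) \<le> lbot \<longleftrightarrow> x = lbot"
  by (auto intro: antisym)

lemma ltop_le_iff [simp]: "ltop \<le> (x::'a::artinian_lattice) \<longleftrightarrow> x = ltop"
  by (auto intro: antisym)

lemma exists_cover:
  assumes "(x::'a::artinian_lattice) \<noteq> ltop"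
  shows "\<exists>y>x. \<forall>z\<ge>x. z \<le> y \<longrightarrow> z = x \<or> z = y"
proof -
  have "ltop \<in> {y. x < y}"
    using assms by (auto simp: order_less_le)
  then obtain y where "x < y" "\<And>z. z < y \<Longrightarrow> \<not> x < z"
    using wfE_min[OF wf_less_artinian, of ltop "{y. x < y}"] by auto
  then show ?thesis
    by (auto simp: order_less_le)
qed

text \<open>A choice of covers is iterated until \<open>ltop\<close> is reached, and finite length
  forces this to happen. From then on the sequence is constant, hence only weak
  monotonicity.\<close>

lemma composition_series:
  obtains c :: "nat \<Rightarrow> 'a::artinian_lattice" and N :: nat where
    "c 0 = lbot" "c N = ltop" "mono c"
    "\<And>i z. c i \<le> z \<Longrightarrow> z \<le> c (Suc i) \<Longrightarrow> z = c i \<or> z = c (Suc i)"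
proof -
  obtain nxt :: "'a \<Rightarrow> 'a" where nxt:
    "\<And>x. x \<noteq> ltop \<Longrightarrow> x < nxt x \<and> (\<forall>z\<ge>x. z \<le> nxt x \<longrightarrow> z = x \<or> z = nxt x)"
    using exists_cover by metis
  define c where "c k = ((\<lambda>x. if x = ltop then x else nxt x) ^^ k) lbot" for k
  have Suc: "c (Suc k) = (if c k = ltop then c k else nxt (c k))" for k
    by (simp add: c_def)
  obtain N where N: "\<And>n c::nat \<Rightarrow> 'a. (\<And>i. i < n \<Longrightarrow> c i < c (Suc i)) \<Longrightarrow> n \<le> N"
    using finite_length by metis
  have "mono c"
    unfolding mono_iff_le_Suc using Suc nxt by (metis order.refl order_less_imp_le)
  have "c (Suc N) = ltop"
  proof (rule ccontr)
    assume *: "c (Suc N) \<noteq> ltop"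
    have strict: "c i < c (Suc i)" if "i < Suc N" for i
    proof -
      have "c i \<noteq> ltop"
        using monoD[OF \<open>mono c\<close>, of i "Suc N"] that * by auto
      then show ?thesis
        using Suc nxt by auto
    qed
    have "Suc N \<le> N"
      by (rule N) (rule strict)
    then show False by simp
  qed
  moreover have "z = c i \<or> z = c (Suc i)" if "c i \<le> z" "z \<le> c (Suc i)" for i z
    using that Suc[of i] nxt[of "c i"] by (auto split: if_splits)
  moreover have "c 0 = lbot"
    by (simp add: c_def)
  ultimately show ?thesis
    using that \<open>mono c\<close> by blast
qed

section \<open>Valuations\<close>

locale strict_valuation =
  fixes v :: "'a::artinian_lattice \<Rightarrow> real"
  assumes strict: "x < y \<Longrightarrow> v x < v y"
    and valuation: "v (sup x y) + v (inf x y) = v x + v y"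
begin

lemma mono_v: "x \<le> y \<Longrightarrow> v x \<le> v y"
  using strict by (auto simp: order_le_less)

lemma eq_if_v_le: "x \<le> y \<Longrightarrow> v y \<le> v x \<Longrightarrow> x = y"
  using strict[of x y] by (auto simp: order_le_less)

lemma v_sup: "v (sup x y) = v x + v y - v (inf x y)"
  using valuation[of x y] by simp

text \<open>The intervals from \<open>x\<close> to \<open>sup x (inf x' y)\<close> and from
  \<open>inf x y\<close> to \<open>inf x' y\<close> are perspective. This converts the size of the
  trace of \<open>y\<close> on the step \<open>[x, x']\<close> into a difference of values on meets,
  which telescopes along chains.\<close>

lemma v_zassenhaus:
  assumes "x \<le> x'"
  shows "v (sup x (inf x' y)) - v x = v (inf x' y) - v (inf x y)"
proof -
  have "inf x (inf x' y) = inf x y"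
    using assms by (simp add: inf_absorb1 inf_assoc[symmetric])
  then show ?thesis
    by (simp add: v_sup)
qed

text \<open>Every value is a partial sum of the jumps along a fixed composition series.\<close>

lemma finite_range_v: "finite (range v)"
proof -
  obtain c :: "nat \<Rightarrow> 'a" and N where c: "c 0 = lbot" "c N = ltop" "mono c"
    "\<And>i z. c i \<le> z \<Longrightarrow> z \<le> c (Suc i) \<Longrightarrow> z = c i \<or> z = c (Suc i)"
    using composition_series by blast
  let ?d = "\<lambda>i. v (c (Suc i)) - v (c i)"
  have "v x \<in> (\<lambda>S. v lbot + sum ?d S) ` Pow {..<N}" for x
  proof -
    \<comment> \<open>The steps of the series on which \<open>x\<close> has a nontrivial trace.
      Since each step has nothing strictly inside, such a trace is the whole step.\<close>
    let ?S = "{i\<in>{..<N}. sup (c i) (inf (c (Suc i)) x) \<noteq> c i}"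
    have le: "c i \<le> c (Suc i)" for i
      using c(3) by (simp add: mono_iff_le_Suc)
    have "v x = v (inf (c N) x)" "v lbot = v (inf (c 0) x)"
      using c by (simp_all add: inf_absorb1 inf_absorb2)
    then have "v x - v lbot = (\<Sum>i<N. v (inf (c (Suc i)) x) - v (inf (c i) x))"
      by (simp only: sum_lessThan_telescope[of "\<lambda>i. v (inf (c i) x)"])
    also have "\<dots> = (\<Sum>i<N. v (sup (c i) (inf (c (Suc i)) x)) - v (c i))"
      using v_zassenhaus[OF le] by simp
    also have "\<dots> = (\<Sum>i<N. if sup (c i) (inf (c (Suc i)) x) \<noteq> c i then ?d i else 0)"
    proof (rule sum.cong)
      fix i assume "i \<in> {..<N}"
      have "sup (c i) (inf (c (Suc i)) x) = c i \<or> sup (c i) (inf (c (Suc i)) x) = c (Suc i)"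
        by (rule c(4)) (use le in auto)
      then show "v (sup (c i) (inf (c (Suc i)) x)) - v (c i) = (if sup (c i) (inf (c (Suc i)) x) \<noteq> c i then ?d i else 0)"
        using \<open>i \<in> {..<N}\<close> by auto
    qed simp
    also have "\<dots> = sum ?d ?S"
      by (rule sum.inter_filter[symmetric]) simp
    finally have "v x = v lbot + sum ?d ?S"
      by simp
    then show ?thesis
      by (intro image_eqI[where x = ?S]) auto
  qed
  then have "range v \<subseteq> (\<lambda>S. v lbot + sum ?d S) ` Pow {..<N}"
    by blast
  then show ?thesis
    by (rule finite_subset) simp
qed

end

section \<open>From homomorphisms on the semigroup of intervals to strict valuations\<close>

lemma K_subgroup_normal: "K_subgroup \<lhd> free_Abelian_group (intervals :: ('a::lattice \<times> 'a) set)"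
proof -
  have "(K_relators :: (('a \<times> 'a) \<Rightarrow>\<^sub>0 int) set) \<subseteq> carrier (free_Abelian_group intervals)"
  proof
    fix r :: "('a \<times> 'a) \<Rightarrow>\<^sub>0 int" assume "r \<in> K_relators"
    then consider a b c where "r = frag_of (a, b) + frag_of (b, c) - frag_of (a, c)" "a \<le> b" "b \<le> c"
      | a b where "r = frag_of (a, sup a b) - frag_of (inf a b, b)"
      unfolding K_relators_def by auto
    then show "r \<in> carrier (free_Abelian_group intervals)"
    proof cases
      case 1
      then have "Poly_Mapping.keys r \<subseteq> {(a, b), (b, c), (a, c)}"
        using keys_diff[of "frag_of (a, b) + frag_of (b, c)" "frag_of (a, c)"]
          keys_add[of "frag_of (a, b)" "frag_of (b, c)"] by auto
      moreover have "{(a, b), (b, c), (a, c)} \<subseteq> intervals"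
        using 1(2,3) by (auto simp: intervals_def)
      ultimately have "Poly_Mapping.keys r \<subseteq> intervals"
        by (rule subset_trans)
      then show ?thesis
        by simp
    next
      case 2
      then have "Poly_Mapping.keys r \<subseteq> {(a, sup a b), (inf a b, b)}"
        using keys_diff[of "frag_of (a, sup a b)" "frag_of (inf a b, b)"] by auto
      moreover have "{(a, sup a b), (inf a b, b)} \<subseteq> intervals"
        by (auto simp: intervals_def)
      ultimately have "Poly_Mapping.keys r \<subseteq> intervals"
        by (rule subset_trans)
      then show ?thesis
        by simp
    qed
  qed
  then have "subgroup K_subgroup (free_Abelian_group (intervals :: ('a \<times> 'a) set))"
    unfolding K_subgroup_def by (intro group.generate_is_subgroup) auto
  then show ?thesis
    by (intro comm_group.normal_iff_subgroup[THEN iffD2] abelian_free_Abelian_group)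
qed

lemma K_coset_eqI:
  fixes x y :: "('a::lattice \<times> 'a) \<Rightarrow>\<^sub>0 int"
  assumes "x - y \<in> K_relators" "Poly_Mapping.keys x \<subseteq> intervals" "Poly_Mapping.keys y \<subseteq> intervals"
  shows "K_subgroup #>\<^bsub>free_Abelian_group intervals\<^esub> x = K_subgroup #>\<^bsub>free_Abelian_group intervals\<^esub> y"
proof -
  interpret N: normal "K_subgroup :: (('a \<times> 'a) \<Rightarrow>\<^sub>0 int) set" "free_Abelian_group intervals"
    by (rule K_subgroup_normal)
  have "x - y \<in> K_subgroup"
    unfolding K_subgroup_def using assms(1) by (rule generate.incl)
  then have "x \<in> K_subgroup #>\<^bsub>free_Abelian_group intervals\<^esub> y"
    unfolding r_coset_def by force
  then show ?thesis
    using N.repr_independence[of x K_subgroup y] assms N.subgroup_axioms by simp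
qed

lemma K_gen_trans:
  assumes "a \<le> b" "b \<le> (c::'a::lattice)"
  shows "K_gen a b \<otimes>\<^bsub>K_group\<^esub> K_gen b c = K_gen a c"
proof -
  interpret N: normal "K_subgroup :: (('a \<times> 'a) \<Rightarrow>\<^sub>0 int) set" "free_Abelian_group intervals"
    by (rule K_subgroup_normal)
  have in_intervals: "(a, b) \<in> intervals" "(b, c) \<in> intervals" "(a, c) \<in> intervals"
    using assms by (auto simp: intervals_def)
  have "K_gen a b \<otimes>\<^bsub>K_group\<^esub> K_gen b c
      = K_subgroup #>\<^bsub>free_Abelian_group intervals\<^esub> (frag_of (a, b) + frag_of (b, c))"
    unfolding K_gen_def K_group_def
    using N.rcos_sum[of "frag_of (a, b)" "frag_of (b, c)"] in_intervals by (simp add: FactGroup_def)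
  also have "\<dots> = K_gen a c"
    unfolding K_gen_def
  proof (rule K_coset_eqI)
    show "frag_of (a, b) + frag_of (b, c) - frag_of (a, c) \<in> K_relators"
      unfolding K_relators_def by (intro UnI1 CollectI exI conjI, rule refl) (use assms in auto)
    show "Poly_Mapping.keys (frag_of (a, b) + frag_of (b, c)) \<subseteq> intervals"
      using keys_add[of "frag_of (a, b)" "frag_of (b, c)"] in_intervals by auto
  qed (use in_intervals in auto)
  finally show ?thesis .
qed

lemma K_gen_diamond: "K_gen a (sup a b) = K_gen (inf a b) (b::'a::lattice)"
  unfolding K_gen_def
proof (rule K_coset_eqI)
  show "frag_of (a, sup a b) - frag_of (inf a b, b) \<in> K_relators"
    unfolding K_relators_def by (intro UnI2 CollectI exI conjI TrueI) (rule refl)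
qed (auto simp: intervals_def)

lemma on_interval_trans:
  assumes "positive_hom X" "a \<le> b" "b \<le> c"
  shows "on_interval X a b + on_interval X b c = on_interval X a c"
proof -
  \<comment> \<open>Degenerate pieces are settled by the convention
    \<open>on_interval X a a = 0\<close>; additivity of \<open>X\<close> is available only on
    \<open>K_plus\<close>.\<close>
  consider "a = b" | "b = c" | "a < b" "b < c"
    using assms by force
  then show ?thesis
  proof cases
    case 3
    then have "X (K_gen a b \<otimes>\<^bsub>K_group\<^esub> K_gen b c) = X (K_gen a b) + X (K_gen b c)"
      using assms(1) K_plus.gen unfolding positive_hom_def by blast
    moreover have "a \<noteq> b" "b \<noteq> c" "a \<noteq> c"
      using 3 by auto
    ultimately show ?thesis
      by (simp add: on_interval_def K_gen_trans[OF assms(2,3)])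
  qed (auto simp: on_interval_def)
qed

lemma on_interval_eq_diff:
  assumes "positive_hom X" "a \<le> b"
  shows "on_interval X a b = on_interval X lbot b - on_interval X lbot a"
  using on_interval_trans[OF assms(1) lbot_le assms(2)] by simp

lemma strict_valuation_on_interval:
  assumes "positive_hom X"
  shows "strict_valuation (on_interval X lbot)"
proof
  fix x y :: 'a
  show "on_interval X lbot x < on_interval X lbot y" if "x < y"
  proof -
    have "0 < on_interval X x y"
      using assms that K_plus.gen[OF that] by (auto simp: on_interval_def positive_hom_def)
    then show ?thesis
      using on_interval_eq_diff[OF assms, of x y] that by simp
  qed
  \<comment> \<open>\<open>on_interval\<close> tests its endpoints for equality, so the two
    perspective intervals must be seen to degenerate together before \<open>K_gen_diamond\<close>
    applies.\<close>
  have "x = sup x y \<longleftrightarrow> inf x y = y"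
    by (metis inf.absorb_iff2 sup.absorb_iff1)
  then have "on_interval X x (sup x y) = on_interval X (inf x y) y"
    by (simp add: on_interval_def K_gen_diamond)
  then show "on_interval X lbot (sup x y) + on_interval X lbot (inf x y)
      = on_interval X lbot x + on_interval X lbot y"
    using on_interval_eq_diff[OF assms, of x "sup x y"] on_interval_eq_diff[OF assms, of "inf x y" y]
    by simp
qed

section \<open>Real filtrations\<close>

text \<open>The claim covers all \<open>d\<close> up to \<open>e\<close>, so that one
  \<open>d\<close> can serve several points at once. The left end \<open>t - d\<close> is included,
  so it is itself not in \<open>T\<close>.\<close>

lemma gap_below:
  fixes T :: "real set"
  assumes "finite T"
  obtains e where "0 < e" "\<And>d. 0 < d \<Longrightarrow> d \<le> e \<Longrightarrow> T \<inter> {t - d..<t} = {}"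
proof (cases "T \<inter> {..<t} = {}")
  case True
  show ?thesis
    by (rule that[of 1]) (use True in force)+
next
  case False
  define m where "m = Max (T \<inter> {..<t})"
  have m: "m < t" "\<And>s. s \<in> T \<Longrightarrow> s < t \<Longrightarrow> s \<le> m"
    using False assms Max_in[of "T \<inter> {..<t}"] by (auto simp: m_def)
  show ?thesis
  proof (rule that[of "(t - m) / 2"])
    fix d assume d: "0 < d" "d \<le> (t - m) / 2"
    have "m < t - d"
      using m(1) d by (simp add: field_simps)
    then show "T \<inter> {t - d..<t} = {}"
      using m(2) by force
  qed (use m in auto)
qed

text \<open>A filtration jumping only at points of \<open>S\<close>; unlike in the definition of
  \<open>R_filtration\<close>, trivial jumps are allowed.\<close>

locale filtration_jumps =
  fixes S :: "real set" and a :: "'a::artinian_lattice filtration"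
  assumes finite_S: "finite S"
    and minus_le_plus: "fminus a t \<le> fplus a t"
    and plus_le_minus: "s < t \<Longrightarrow> fplus a s \<le> fminus a t"
    and no_jump_between: "s < t \<Longrightarrow> S \<inter> {s<..<t} = {} \<Longrightarrow> fplus a s = fminus a t"
    and no_jump: "t \<notin> S \<Longrightarrow> fminus a t = fplus a t"
    and no_jump_below: "S \<inter> {..<t} = {} \<Longrightarrow> fminus a t = lbot"
    and no_jump_above: "S \<inter> {t<..} = {} \<Longrightarrow> fplus a t = ltop"
begin

lemma plus_mono: "s \<le> t \<Longrightarrow> fplus a s \<le> fplus a t"
  using plus_le_minus[of s t] minus_le_plus[of t] by (cases "s = t") auto

lemma minus_mono: "s \<le> t \<Longrightarrow> fminus a s \<le> fminus a t"
  using plus_le_minus[of s t] minus_le_plus[of s] by (cases "s = t") auto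

lemma supp_subset: "supp a \<subseteq> S"
  using no_jump by (force simp: supp_def)

lemma plus_no_jump_between:
  assumes "s < t" "S \<inter> {s<..t} = {}"
  shows "fplus a t = fplus a s"
proof -
  have "t \<notin> S" "S \<inter> {s<..<t} = {}"
    using assms by auto
  then show ?thesis
    using no_jump no_jump_between assms(1) by metis
qed

text \<open>\<open>fminus\<close> is the left limit of \<open>fplus\<close>. The shift
  \<open>e\<close> is common to both points, so that a property of \<open>fplus\<close> on windows
  of length one passes to \<open>fminus\<close>.\<close>

lemma minus_eq_plus_below:
  obtains e where "0 < e" "fminus a t = fplus a (t - e)" "fminus a u = fplus a (u - e)"
proof -
  obtain e1 where e1: "0 < e1" "\<And>d. 0 < d \<Longrightarrow> d \<le> e1 \<Longrightarrow> S \<inter> {t - d..<t} = {}"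
    using gap_below[OF finite_S] by blast
  obtain e2 where e2: "0 < e2" "\<And>d. 0 < d \<Longrightarrow> d \<le> e2 \<Longrightarrow> S \<inter> {u - d..<u} = {}"
    using gap_below[OF finite_S] by blast
  define e where "e = min e1 e2"
  have e: "0 < e" "e \<le> e1" "e \<le> e2"
    using e1(1) e2(1) by (auto simp: e_def)
  have "fplus a (t - e) = fminus a t" "fplus a (u - e) = fminus a u"
    using e e1(2)[of e] e2(2)[of e] by (auto intro!: no_jump_between)
  then show ?thesis
    using that[of e] e by simp
qed

text \<open>Telescoping, by splitting off the last jump point up to \<open>s\<close>. The function
  \<open>g\<close> is arbitrary so that it may also measure traces on a fixed element.\<close>

lemma sum_jumps:
  fixes g :: "'a \<Rightarrow> real"
  shows "(\<Sum>t\<in>{t\<in>S. t \<le> s}. g (fplus a t) - g (fminus a t)) = g (fplus a s) - g lbot"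
proof (induction "card {t\<in>S. t \<le> s}" arbitrary: s rule: less_induct)
  case less
  show ?case
  proof (cases "{t\<in>S. t \<le> s} = {}")
    case True
    then have "S \<inter> {..<s} = {}" "s \<notin> S"
      by auto
    then have "fplus a s = lbot"
      using no_jump no_jump_below by metis
    with True show ?thesis
      by (simp only: sum.empty)
  next
    case False
    define m where "m = Max {t\<in>S. t \<le> s}"
    have m: "m \<in> S" "m \<le> s" "\<And>t. t \<in> S \<Longrightarrow> t \<le> s \<Longrightarrow> t \<le> m"
      using False finite_S Max_in[of "{t\<in>S. t \<le> s}"] by (auto simp: m_def)
    have plus: "fplus a s = fplus a m"
    proof (cases "m = s")
      case False
      then show ?thesis
        using m by (intro plus_no_jump_between) force+
    qed simp
    obtain e where e: "0 < e" "S \<inter> {m - e..<m} = {}"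
      using gap_below[OF finite_S, of m] by (metis order_refl)
    have minus: "fminus a m = fplus a (m - e)"
      using e by (subst no_jump_between[of "m - e" m]) auto
    have split: "{t\<in>S. t \<le> s} = insert m {t\<in>S. t \<le> m - e}" "m \<notin> {t\<in>S. t \<le> m - e}"
      using m e by force+
    have "card {t\<in>S. t \<le> m - e} < card {t\<in>S. t \<le> s}"
      using split finite_S by (simp add: card_insert_if)
    from less.hyps[OF this] show ?thesis
      using split finite_S by (simp add: plus minus)
  qed
qed

lemma jumps_shift: "filtration_jumps ((\<lambda>t. t + r) ` S) (\<lambda>t. fminus a (t - r), \<lambda>t. fplus a (t - r))"
proof
  have mem: "t \<in> (\<lambda>t. t + r) ` S \<longleftrightarrow> t - r \<in> S" for t
    by (force intro: image_eqI[where x = "t - r"])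
  show "finite ((\<lambda>t. t + r) ` S)"
    using finite_S by simp
  fix s t :: real
  show "fminus (\<lambda>t. fminus a (t - r), \<lambda>t. fplus a (t - r)) t
      \<le> fplus (\<lambda>t. fminus a (t - r), \<lambda>t. fplus a (t - r)) t"
    by (simp add: minus_le_plus)
  show "fplus (\<lambda>t. fminus a (t - r), \<lambda>t. fplus a (t - r)) s
      \<le> fminus (\<lambda>t. fminus a (t - r), \<lambda>t. fplus a (t - r)) t" if "s < t"
    using that by (simp add: plus_le_minus)
  show "fplus (\<lambda>t. fminus a (t - r), \<lambda>t. fplus a (t - r)) s
      = fminus (\<lambda>t. fminus a (t - r), \<lambda>t. fplus a (t - r)) t"
    if "s < t" and *: "(\<lambda>t. t + r) ` S \<inter> {s<..<t} = {}"
  proof -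
    have "S \<inter> {s - r<..<t - r} = {}"
      using * by force
    then show ?thesis
      using that no_jump_between[of "s - r" "t - r"] by simp
  qed
  show "fminus (\<lambda>t. fminus a (t - r), \<lambda>t. fplus a (t - r)) t
      = fplus (\<lambda>t. fminus a (t - r), \<lambda>t. fplus a (t - r)) t" if "t \<notin> (\<lambda>t. t + r) ` S"
    using that mem no_jump by simp
  show "fminus (\<lambda>t. fminus a (t - r), \<lambda>t. fplus a (t - r)) t = lbot"
    if *: "(\<lambda>t. t + r) ` S \<inter> {..<t} = {}"
  proof -
    have "S \<inter> {..<t - r} = {}"
      using * by force
    then show ?thesis
      using no_jump_below by simp
  qed
  show "fplus (\<lambda>t. fminus a (t - r), \<lambda>t. fplus a (t - r)) t = ltop"
    if *: "(\<lambda>t. t + r) ` S \<inter> {t<..} = {}"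
  proof -
    have "S \<inter> {t - r<..} = {}"
      using * by force
    then show ?thesis
      using no_jump_above by simp
  qed
qed

text \<open>Points of \<open>S\<close> with a trivial jump can be discarded: the filtration passes
  through them unchanged, by induction on their number in \<open>between\<close>.\<close>

lemma jumps_supp: "filtration_jumps (supp a) a"
proof
  show "finite (supp a)"
    using finite_subset[OF supp_subset finite_S] .
  fix s t :: real
  show "fminus a t \<le> fplus a t" by (rule minus_le_plus)
  show "s < t \<Longrightarrow> fplus a s \<le> fminus a t" by (rule plus_le_minus)
  show "t \<notin> supp a \<Longrightarrow> fminus a t = fplus a t" by (simp add: supp_def)
  have between: "s < t \<Longrightarrow> supp a \<inter> {s<..<t} = {} \<Longrightarrow> fplus a s = fminus a t" for s t
  proof (induction "card (S \<inter> {s<..<t})" arbitrary: t rule: less_induct)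
    case less
    show ?case
    proof (cases "S \<inter> {s<..<t} = {}")
      case False
      define p where "p = Max (S \<inter> {s<..<t})"
      have p: "p \<in> S" "s < p" "p < t" "\<And>u. u \<in> S \<Longrightarrow> s < u \<Longrightarrow> u < t \<Longrightarrow> u \<le> p"
        using False finite_S Max_in[of "S \<inter> {s<..<t}"] by (auto simp: p_def)
      have "S \<inter> {s<..<p} \<subset> S \<inter> {s<..<t}"
        using p by auto
      then have "card (S \<inter> {s<..<p}) < card (S \<inter> {s<..<t})"
        using finite_S by (intro psubset_card_mono) auto
      moreover have "supp a \<inter> {s<..<p} = {}"
        using less.prems p by auto
      ultimately have "fplus a s = fminus a p"
        using less.hyps p by blast
      also have "\<dots> = fplus a p"
        using less.prems p by (force simp: supp_def)
      also have "\<dots> = fminus a t"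
        using p by (intro no_jump_between) force+
      finally show ?thesis .
    qed (use no_jump_between less.prems in auto)
  qed
  show "s < t \<Longrightarrow> supp a \<inter> {s<..<t} = {} \<Longrightarrow> fplus a s = fminus a t" by (rule between)
  show "fminus a t = lbot" if *: "supp a \<inter> {..<t} = {}"
  proof -
    \<comment> \<open>A point to the left of \<open>t\<close> and of all of \<open>S\<close>, where
      the value is already known to be \<open>lbot\<close>; inserting \<open>t\<close> also covers
      empty \<open>S\<close>.\<close>
    define s where "s = Min (insert t S) - 1"
    have less: "s < u" if "u \<in> insert t S" for u
    proof -
      have "Min (insert t S) \<le> u"
        using finite_S that by (intro Min_le) auto
      then show ?thesis
        unfolding s_def by linarith
    qed
    then have s: "s < t" "s \<notin> S" "S \<inter> {..<s} = {}"
      by force+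
    then have "fplus a s = lbot"
      using no_jump no_jump_below by metis
    moreover have "supp a \<inter> {s<..<t} = {}"
      using * by auto
    ultimately show ?thesis
      using between s by metis
  qed
  show "fplus a t = ltop" if *: "supp a \<inter> {t<..} = {}"
  proof -
    define s where "s = Max (insert t S) + 1"
    have less: "u < s" if "u \<in> insert t S" for u
    proof -
      have "u \<le> Max (insert t S)"
        using finite_S that by (intro Max_ge) auto
      then show ?thesis
        unfolding s_def by linarith
    qed
    then have s: "t < s" "s \<notin> S" "S \<inter> {s<..} = {}"
      by force+
    then have "fminus a s = ltop"
      using no_jump no_jump_above by metis
    moreover have "supp a \<inter> {t<..<s} = {}"
      using * by auto
    ultimately show ?thesis
      using between s by metis
  qed
qed

end

section \<open>Filtrations given by a chain with weights\<close>

definition step_filtration :: "nat \<Rightarrow> (nat \<Rightarrow> real) \<Rightarrow> (nat \<Rightarrow> 'a) \<Rightarrow> 'a filtration" where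
  "step_filtration n l c =
     (\<lambda>t. c (card {j\<in>{1..n}. l j < t}), \<lambda>t. c (card {j\<in>{1..n}. l j \<le> t}))"

lemma card_prefix_le: "card {j\<in>{1..n}. P j} \<le> n"
proof -
  have "card {j\<in>{1..n}. P j} \<le> card {1..n}"
    by (rule card_mono) auto
  then show ?thesis
    by simp
qed

text \<open>A downward closed predicate holds on an initial segment, and the cardinality of that
  segment is its last index.\<close>

lemma le_card_prefix_iff:
  assumes "1 \<le> k" "k \<le> n" "\<And>i j. 1 \<le> i \<Longrightarrow> i \<le> j \<Longrightarrow> j \<le> n \<Longrightarrow> P j \<Longrightarrow> P i"
  shows "k \<le> card {j\<in>{1..n}. P j} \<longleftrightarrow> P k"
proof
  assume "P k"
  then have "{1..k} \<subseteq> {j\<in>{1..n}. P j}"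
    using assms by auto
  from card_mono[OF _ this] show "k \<le> card {j\<in>{1..n}. P j}"
    by simp
next
  assume k: "k \<le> card {j\<in>{1..n}. P j}"
  show "P k"
  proof (rule ccontr)
    assume "\<not> P k"
    then have "{j\<in>{1..n}. P j} \<subseteq> {1..<k}"
      using assms by (auto simp: not_le[symmetric])
    from card_mono[OF _ this] show False
      using k assms(1) by simp
  qed
qed

lemma le_card_less_iff:
  fixes l :: "nat \<Rightarrow> real"
  assumes "mono_on {1..n} l" "1 \<le> k" "k \<le> n"
  shows "k \<le> card {j\<in>{1..n}. l j < t} \<longleftrightarrow> l k < t"
proof (rule le_card_prefix_iff)
  show "l i < t" if "1 \<le> i" "i \<le> j" "j \<le> n" "l j < t" for i j
    using mono_onD[OF assms(1), of i j] that by simp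
qed fact+

lemma le_card_le_iff:
  fixes l :: "nat \<Rightarrow> real"
  assumes "mono_on {1..n} l" "1 \<le> k" "k \<le> n"
  shows "k \<le> card {j\<in>{1..n}. l j \<le> t} \<longleftrightarrow> l k \<le> t"
proof (rule le_card_prefix_iff)
  show "l i \<le> t" if "1 \<le> i" "i \<le> j" "j \<le> n" "l j \<le> t" for i j
    using mono_onD[OF assms(1), of i j] that by simp
qed fact+

text \<open>Repetitions are allowed: equal weights merge several steps into one jump, and repeated
  elements give trivial jumps. Minimising over a closed set of weights can lead to the
  former.\<close>

lemma jumps_step_filtration:
  fixes c :: "nat \<Rightarrow> 'a::artinian_lattice"
  assumes "mono_on {0..n} c" "c 0 = lbot" "c n = ltop"
  shows "filtration_jumps (l ` {1..n}) (step_filtration n l c)"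
proof
  have mono: "c (card {j\<in>{1..n}. P j}) \<le> c (card {j\<in>{1..n}. Q j})" if "\<And>j. P j \<Longrightarrow> Q j" for P Q
  proof (rule mono_onD[OF assms(1)])
    show "card {j\<in>{1..n}. P j} \<le> card {j\<in>{1..n}. Q j}"
      using that by (auto intro: card_mono)
  qed (use card_prefix_le in auto)
  fix s t :: real
  show "fminus (step_filtration n l c) t \<le> fplus (step_filtration n l c) t"
    unfolding step_filtration_def fst_conv snd_conv by (rule mono) simp
  show "fplus (step_filtration n l c) s \<le> fminus (step_filtration n l c) t" if "s < t"
    unfolding step_filtration_def fst_conv snd_conv by (rule mono) (use that in simp)
  show "fplus (step_filtration n l c) s = fminus (step_filtration n l c) t"
    if "s < t" "l ` {1..n} \<inter> {s<..<t} = {}"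
  proof -
    have "l j \<le> s \<longleftrightarrow> l j < t" if "j \<in> {1..n}" for j
      using \<open>s < t\<close> \<open>l ` {1..n} \<inter> {s<..<t} = {}\<close> that by (force simp: not_le)
    then have "{j\<in>{1..n}. l j \<le> s} = {j\<in>{1..n}. l j < t}"
      by blast
    then show ?thesis
      by (simp add: step_filtration_def)
  qed
  show "fminus (step_filtration n l c) t = fplus (step_filtration n l c) t" if "t \<notin> l ` {1..n}"
  proof -
    have "{j\<in>{1..n}. l j < t} = {j\<in>{1..n}. l j \<le> t}"
      using that by (auto simp: order_le_less)
    then show ?thesis
      by (simp add: step_filtration_def)
  qed
  show "fminus (step_filtration n l c) t = lbot" if "l ` {1..n} \<inter> {..<t} = {}"
  proof -
    have "{j\<in>{1..n}. l j < t} = {}"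
      using that by (force simp: disjoint_iff)
    then show ?thesis
      by (simp only: step_filtration_def fst_conv card.empty assms)
  qed
  show "fplus (step_filtration n l c) t = ltop" if "l ` {1..n} \<inter> {t<..} = {}"
  proof -
    have "{j\<in>{1..n}. l j \<le> t} = {1..n}"
      using that by (force simp: not_less[symmetric])
    then show ?thesis
      by (simp add: step_filtration_def assms)
  qed
qed simp

lemma R_filtration_imp_step:
  fixes a :: "'a::artinian_lattice filtration"
  assumes "R_filtration a"
  obtains n l c where "a = step_filtration n l c" "strict_mono_on {1..n} l" "strict_mono_on {0..n} c"
    "c 0 = lbot" "c n = ltop"
proof -
  obtain n l c where *: "strict_mono_on {1..n} l" "strict_mono_on {0..n} c"
    "\<And>x. c 0 \<le> x" "\<And>x. x \<le> c n"
    "\<And>t. fplus a t = c (card {j\<in>{1..n}. l j \<le> t})"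
    "\<And>t. fminus a t = c (card {j\<in>{1..n}. l j < t})"
    using assms unfolding R_filtration_def by blast
  have "a = step_filtration n l c"
    unfolding step_filtration_def by (rule prod_eqI) (simp_all add: fun_eq_iff *)
  moreover have "c 0 = lbot" "c n = ltop"
    using *(3)[of lbot] *(4)[of ltop] by simp_all
  ultimately show ?thesis
    using that * by blast
qed

lemma R_filtration_jumps:
  assumes "R_filtration a"
  shows "filtration_jumps (supp a) a"
proof -
  obtain n l c where *: "a = step_filtration n l c" "strict_mono_on {0..n} c"
    "c 0 = lbot" "c n = ltop"
    using R_filtration_imp_step[OF assms] by metis
  then have "filtration_jumps (l ` {1..n}) a"
    using strict_mono_on_imp_mono_on jumps_step_filtration by blast
  then show ?thesis
    by (rule filtration_jumps.jumps_supp)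
qed

text \<open>The data required by \<open>R_filtration\<close> are read off from the genuine jumps:
  the sorted support gives the weights, and the values of \<open>fplus\<close> there give the chain
  above \<open>lbot\<close>.\<close>

lemma (in filtration_jumps) R_filtration: "R_filtration a"
proof -
  define S' where "S' = supp a"
  interpret A: filtration_jumps S' a
    unfolding S'_def by (rule jumps_supp)
  define n where "n = card S'"
  define xs where "xs = sorted_list_of_set S'"
  \<comment> \<open>Weights are indexed from 1 and lists from 0; index 0 of the chain is reserved
    for \<open>lbot\<close>.\<close>
  define l where "l j = xs ! (j - 1)" for j
  define c where "c k = (if k = 0 then lbot else fplus a (l k))" for k
  have len: "length xs = n"
    by (simp add: xs_def n_def)
  have l: "strict_mono_on {1..n} l"
    unfolding l_def using sorted_wrt_nth_less[OF strict_sorted_list_of_set, of _ _ S']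
    by (auto simp: strict_mono_on_def xs_def n_def)
  have "l ` {1..n} = set xs"
  proof (intro equalityI subsetI)
    fix x assume "x \<in> set xs"
    then obtain i where "i < n" "x = xs ! i"
      using len by (auto simp: in_set_conv_nth)
    then show "x \<in> l ` {1..n}"
      by (intro image_eqI[where x = "Suc i"]) (auto simp: l_def)
  qed (use len in \<open>auto simp: l_def\<close>)
  then have im: "l ` {1..n} = S'"
    using A.finite_S by (simp add: xs_def)
  have less_iff: "l i < l j \<longleftrightarrow> i < j" "l i \<le> l j \<longleftrightarrow> i \<le> j" if "i \<in> {1..n}" "j \<in> {1..n}" for i j
    using strict_mono_on_less[OF l that] strict_mono_on_less_eq[OF l that] by auto
  have jump: "fminus a (l k) < fplus a (l k)" if "k \<in> {1..n}" for k
  proof -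
    have "l k \<in> supp a"
      using im that by (auto simp: S'_def)
    then show ?thesis
      using minus_le_plus[of "l k"] by (auto simp: supp_def order_less_le)
  qed
  have c: "strict_mono_on {0..n} c"
  proof (rule strict_mono_onI)
    fix i j assume ij: "i \<in> {0..n}" "j \<in> {0..n}" "i < j"
    have "c i \<le> fminus a (l j)"
      using ij less_iff[of i j] by (auto simp: c_def intro!: plus_le_minus)
    also have "\<dots> < c j"
      using jump[of j] ij by (simp add: c_def)
    finally show "c i < c j" .
  qed
  have le: "fplus a t = c (card {j\<in>{1..n}. l j \<le> t})" for t
  proof (cases "{j\<in>{1..n}. l j \<le> t} = {}")
    case True
    then have "S' \<inter> {..<t} = {}" "t \<notin> S'"
      using im by force+
    then have "fplus a t = lbot"
      using A.no_jump A.no_jump_below by metis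
    then show ?thesis
      using True by (simp only: c_def card.empty if_True refl)
  next
    case False
    define k where "k = Max {j\<in>{1..n}. l j \<le> t}"
    have k: "k \<in> {1..n}" "l k \<le> t" "\<And>j. j \<in> {1..n} \<Longrightarrow> l j \<le> t \<Longrightarrow> j \<le> k"
      using Max_in[OF _ False] Max_ge[of "{j\<in>{1..n}. l j \<le> t}"] by (auto simp: k_def)
    have "{j\<in>{1..n}. l j \<le> t} = {1..k}"
      using k less_iff by (auto intro: order_trans[of _ "l k"])
    moreover have "fplus a t = fplus a (l k)"
    proof (cases "l k = t")
      case False
      have "l j \<le> l k" if "j \<in> {1..n}" "l j \<le> t" for j
        using that k less_iff(2)[of j k] by blast
      then have "S' \<inter> {l k<..t} = {}"
        unfolding im[symmetric] by (auto simp: not_le[symmetric])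
      then show ?thesis
        using A.plus_no_jump_between k False by simp
    qed simp
    ultimately show ?thesis
      using k by (simp add: c_def)
  qed
  have less: "fminus a t = c (card {j\<in>{1..n}. l j < t})" for t
  proof (cases "{j\<in>{1..n}. l j < t} = {}")
    case True
    then have "S' \<inter> {..<t} = {}"
      using im by force+
    then have "fminus a t = lbot"
      using A.no_jump_below by metis
    then show ?thesis
      using True by (simp only: c_def card.empty if_True refl)
  next
    case False
    define k where "k = Max {j\<in>{1..n}. l j < t}"
    have k: "k \<in> {1..n}" "l k < t" "\<And>j. j \<in> {1..n} \<Longrightarrow> l j < t \<Longrightarrow> j \<le> k"
      using Max_in[OF _ False] Max_ge[of "{j\<in>{1..n}. l j < t}"] by (auto simp: k_def)
    have "{j\<in>{1..n}. l j < t} = {1..k}"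
      using k less_iff by (auto intro: le_less_trans[of _ "l k"])
    moreover have "l j \<le> l k" if "j \<in> {1..n}" "l j < t" for j
      using that k less_iff(2)[of j k] by blast
    then have "S' \<inter> {l k<..<t} = {}"
      unfolding im[symmetric] by (auto simp: not_le[symmetric])
    then have "fminus a t = fplus a (l k)"
      using A.no_jump_between k by simp
    ultimately show ?thesis
      using k by (simp add: c_def)
  qed
  have "c n = ltop"
  proof -
    define t where "t = Max (insert 0 S')"
    have t: "\<And>s. s \<in> S' \<Longrightarrow> s \<le> t"
      using A.finite_S by (simp add: t_def)
    then have "{j\<in>{1..n}. l j \<le> t} = {1..n}"
      using im by auto
    then have "c n = fplus a t"
      by (simp add: le)
    also have "S' \<inter> {t<..} = {}"
      using t by force
    then have "fplus a t = ltop"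
      by (rule A.no_jump_above)
    finally show ?thesis .
  qed
  moreover have "c 0 = lbot"
    by (simp add: c_def)
  ultimately show ?thesis
    unfolding R_filtration_def
    using l c le less plus_mono minus_mono by (auto simp: mono_def intro!: exI[of _ n] exI[of _ l] exI[of _ c])
qed

section \<open>Paracomplemented filtrations\<close>

text \<open>The interval at \<open>t\<close> collects the steps with weight in the half-open window
  \<open>(t, t + 1]\<close>. A pair of weights at distance at least one never fits into it, so a
  non-strict inequality suffices. This makes paracomplementedness a closed condition on the
  weights.\<close>

lemma paracomplemented_step_filtration:
  fixes c :: "nat \<Rightarrow> 'a::artinian_lattice"
  assumes l: "mono_on {1..n} l"
    and spread: "\<And>i j. i < j \<Longrightarrow> j \<le> n \<Longrightarrow> \<not> complemented_interval (c i) (c j) \<Longrightarrow> l j - l (Suc i) \<ge> 1"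
  shows "paracomplemented (step_filtration n l c)"
  unfolding paracomplemented_def
proof
  fix t
  let ?i = "card {j\<in>{1..n}. l j \<le> t}" and ?j = "card {j\<in>{1..n}. l j \<le> t + 1}"
  have "complemented_interval (c ?i) (c ?j)"
  proof (rule ccontr)
    assume *: "\<not> complemented_interval (c ?i) (c ?j)"
    have "?i \<le> ?j"
      by (rule card_mono) auto
    then have "?i < ?j"
      using * by (cases "?i = ?j") auto
    moreover have "?j \<le> n"
      by (rule card_prefix_le)
    ultimately have "l ?j - l (Suc ?i) \<ge> 1"
      using spread * by blast
    moreover have "l ?j \<le> t + 1"
      using le_card_le_iff[OF l, of ?j "t + 1"] \<open>?i < ?j\<close> \<open>?j \<le> n\<close> by simp
    moreover have "t < l (Suc ?i)"
      using le_card_le_iff[OF l, of "Suc ?i" t] \<open>?i < ?j\<close> \<open>?j \<le> n\<close> by simp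
    ultimately show False
      by simp
  qed
  then show "complemented_interval (fplus (step_filtration n l c) t) (fplus (step_filtration n l c) (t + 1))"
    by (simp add: step_filtration_def)
qed

lemma step_filtration_paracomplementedD:
  fixes c :: "nat \<Rightarrow> 'a::artinian_lattice"
  assumes l: "mono_on {1..n} l" and c: "mono_on {0..n} c"
    and para: "paracomplemented (step_filtration n l c)"
    and ij: "i < j" "j \<le> n" "\<not> complemented_interval (c i) (c j)"
  shows "l j - l (Suc i) \<ge> 1"
proof (rule ccontr)
  assume "\<not> l j - l (Suc i) \<ge> 1"
  then have t: "l j - 1 < l (Suc i)"
    by simp
  \<comment> \<open>The window \<open>(l j - 1, l j]\<close> would contain all weights from index
    \<open>Suc i\<close> to \<open>j\<close>, hence its interval would contain
    \<open>[c i, c j]\<close>.\<close>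
  let ?i = "card {k\<in>{1..n}. l k \<le> l j - 1}" and ?j = "card {k\<in>{1..n}. l k \<le> l j - 1 + 1}"
  have "complemented_interval (c ?i) (c ?j)"
    using para unfolding paracomplemented_def step_filtration_def fst_conv snd_conv by blast
  moreover have "?i \<le> i"
    using le_card_le_iff[OF l, of "Suc i" "l j - 1"] t ij by simp
  then have "c ?i \<le> c i"
    using ij by (intro mono_onD[OF c]) auto
  moreover have "j \<le> ?j"
    using le_card_le_iff[OF l, of j "l j - 1 + 1"] ij by simp
  then have "c j \<le> c ?j"
    using ij card_prefix_le[of n] by (intro mono_onD[OF c]) auto
  ultimately show False
    using ij complemented_subinterval by blast
qed

section \<open>Bounds and intervals of \<open>Lambda a\<close>, and the linear form of
  semistability\<close>

locale para_filtration = filtration_jumps "supp a" a for a :: "'a::artinian_lattice filtration" +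
  assumes para: "paracomplemented a"
begin

lemma para_plus: "complemented_interval (fplus a t) (fplus a (t + 1))"
  using para by (simp add: paracomplemented_def)

lemma para_minus: "complemented_interval (fminus a t) (fminus a (t + 1))"
proof -
  obtain e where "fminus a t = fplus a (t - e)" "fminus a (t + 1) = fplus a (t + 1 - e)"
    by (rule minus_eq_plus_below)
  then show ?thesis
    using para_plus[of "t - e"] by (simp add: algebra_simps)
qed

lemma fminus_in_Lambda: "fminus a \<in> Lambda a"
  using complemented_intervalD[OF para_minus minus_le_plus plus_le_minus] minus_le_plus
  by (simp add: Lambda_def)

lemma fplus_in_Lambda: "fplus a \<in> Lambda a"
proof -
  have "has_complement_in (fplus a t) (fplus a (t + 1)) (fplus a t)" for t
    using plus_mono[of t "t + 1"]
    by (intro has_complement_inI[where b = "fplus a (t + 1)"]) (simp_all add: inf_absorb1 sup_absorb2)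
  then show ?thesis
    using minus_le_plus by (simp add: Lambda_def)
qed

lemma Lambda_between: "x \<in> Lambda a \<Longrightarrow> fminus a t \<le> x t" "x \<in> Lambda a \<Longrightarrow> x t \<le> fplus a t"
  by (auto simp: Lambda_def)

lemma Least_Lambda: "(LEAST x. x \<in> Lambda a) = fminus a"
  by (rule Least_equality) (auto simp: fminus_in_Lambda le_fun_def Lambda_between)

lemma Greatest_Lambda: "(GREATEST x. x \<in> Lambda a) = fplus a"
  by (rule Greatest_equality) (auto simp: fplus_in_Lambda le_fun_def Lambda_between)

text \<open>Both steps \<open>[x t, a\<^sub>+ t]\<close> and \<open>[a\<^sub>+ t, x (t+1)]\<close> lie in complemented intervals.\<close>

lemma complemented_Lambda:
  assumes "x \<in> Lambda a"
  shows "complemented_interval (x t) (x (t + 1))"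
proof (rule complemented_interval_glue)
  show "complemented_interval (x t) (fplus a t)"
    by (rule complemented_subinterval[OF para_minus[of t]])
      (simp_all add: Lambda_between assms plus_le_minus)
  show "complemented_interval (fplus a t) (x (t + 1))"
    by (rule complemented_subinterval[OF para_plus[of t]])
      (simp_all add: Lambda_between assms)
  show "has_complement_in (x t) (x (t + 1)) (fplus a t)" "x t \<le> fplus a t" "fplus a t \<le> x (t + 1)"
    using assms plus_le_minus[of t "t + 1"] by (auto simp: Lambda_def intro: order_trans)
qed

end

lemma para_filtration_iff: "para_filtration a \<longleftrightarrow> a \<in> B_filtrations"
  unfolding B_filtrations_def para_filtration_def para_filtration_axioms_def
  using R_filtration_jumps filtration_jumps.R_filtration by blast

text \<open>The sums are the imaginary parts of \<open>Z_Lambda\<close>, with \<open>X\<close>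
  expressed through the valuation \<open>v\<close>. As real parts are nonnegative, the sign of the
  phase is the sign of the imaginary part.\<close>

definition phase_zero_semistable :: "('a::artinian_lattice \<Rightarrow> real) \<Rightarrow> 'a filtration \<Rightarrow> bool" where
  "phase_zero_semistable v a \<longleftrightarrow>
     (\<forall>x\<in>Lambda a. (\<Sum>t\<in>supp a. t * (v (x t) - v (fminus a t))) \<le> 0) \<and>
     (\<Sum>t\<in>supp a. t * (v (fplus a t) - v (fminus a t))) = 0"

lemma semistable_phase_zero_iff:
  fixes X :: "(('a::artinian_lattice \<times> 'a) \<Rightarrow>\<^sub>0 int) set \<Rightarrow> real"
  assumes X: "positive_hom X" and "a \<in> B_filtrations"
  shows "semistable (Lambda a) (Z_Lambda X a) \<and> lattice_phase (Lambda a) (Z_Lambda X a) = 0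
    \<longleftrightarrow> phase_zero_semistable (on_interval X lbot) a"
proof -
  interpret para_filtration a
    using assms(2) by (simp add: para_filtration_iff)
  interpret strict_valuation "on_interval X lbot"
    using X by (rule strict_valuation_on_interval)
  let ?v = "on_interval X lbot"
  have Z: "Z_Lambda X a (fminus a) x = (\<Sum>t\<in>supp a. (1 + of_real t * \<i>) * of_real (?v (x t) - ?v (fminus a t)))"
    if "x \<in> Lambda a" for x
    unfolding Z_Lambda_def
    by (intro sum.cong refl) (metis on_interval_eq_diff[OF X] Lambda_between(1)[OF that])
  have Re: "Re (Z_Lambda X a (fminus a) x) \<ge> 0" if "x \<in> Lambda a" for x
    unfolding Z[OF that] Re_sum by (rule sum_nonneg) (simp add: mono_v Lambda_between(1)[OF that])
  have Im: "Im (Z_Lambda X a (fminus a) x) = (\<Sum>t\<in>supp a. t * (?v (x t) - ?v (fminus a t)))"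
    if "x \<in> Lambda a" for x
    unfolding Z[OF that] Im_sum by simp
  \<comment> \<open>A nonnegative real part excludes \<open>Arg = pi\<close>, so a vanishing
    imaginary part gives argument \<open>0\<close>.\<close>
  have Arg_le: "Arg (Z_Lambda X a (fminus a) x) \<le> 0 \<longleftrightarrow> Im (Z_Lambda X a (fminus a) x) \<le> 0"
    if "x \<in> Lambda a" for x
    using Re[OF that] Arg_lt_pi Arg_neg_iff Arg_eq_0 Arg_less_0
    by (smt (verit, best) complex_is_Real_iff)
  have phase: "lattice_phase (Lambda a) (Z_Lambda X a) = 0
      \<longleftrightarrow> (\<Sum>t\<in>supp a. t * (?v (fplus a t) - ?v (fminus a t))) = 0"
    unfolding lattice_phase_def Least_Lambda Greatest_Lambda Arg_eq_0
    using Re[OF fplus_in_Lambda] Im[OF fplus_in_Lambda] by (simp add: complex_is_Real_iff)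
  have "semistable (Lambda a) (Z_Lambda X a) \<longleftrightarrow>
      (\<forall>x\<in>Lambda a. (\<Sum>t\<in>supp a. t * (?v (x t) - ?v (fminus a t))) \<le> 0)"
    if zero: "lattice_phase (Lambda a) (Z_Lambda X a) = 0"
  proof -
    \<comment> \<open>The bounds of \<open>Lambda a\<close> are exempt in \<open>semistable\<close>;
      at phase zero their sums vanish, so they may be included in the quantifier.\<close>
    have "(\<Sum>t\<in>supp a. t * (?v (x t) - ?v (fminus a t))) \<le> 0"
      if "x = fminus a \<or> x = fplus a" for x
      using that zero phase by auto
    moreover have "Arg (Z_Lambda X a (fminus a) x) \<le> 0
        \<longleftrightarrow> (\<Sum>t\<in>supp a. t * (?v (x t) - ?v (fminus a t))) \<le> 0" if "x \<in> Lambda a" for x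
      using Arg_le[OF that] Im[OF that] by simp
    ultimately show ?thesis
      unfolding semistable_def zero Least_Lambda Greatest_Lambda by blast
  qed
  then show ?thesis
    unfolding phase_zero_semistable_def using phase by blast
qed

section \<open>Uniqueness\<close>

text \<open>By perspectivity the interval is a copy of the part of \<open>[b, b']\<close> below
  \<open>sup b (inf s b')\<close>. A complement \<open>w\<close> of \<open>sup b y\<close> is pulled
  back to \<open>inf s w\<close>.\<close>

lemma complemented_interval_inf:
  fixes b b' s :: "'a::artinian_lattice"
  assumes "complemented_interval b b'" "b \<le> b'"
  shows "complemented_interval (inf s b) (inf s b')"
  unfolding complemented_interval_def
proof
  fix y assume y: "y \<in> {inf s b..inf s b'}"
  then have y': "inf s b \<le> y" "y \<le> s" "y \<le> b'"
    by auto
  obtain w where w: "inf (sup b y) w = b" "sup (sup b y) w = b'" "b \<le> w"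
    using complemented_intervalD[OF assms(1), of "sup b y"] assms(2) y'
    by (auto elim!: has_complement_inE)
  show "has_complement_in (inf s b) (inf s b') y"
  proof (rule has_complement_inI)
    have "inf y w \<le> b"
      using w(1) by (metis inf_mono order_refl sup_ge2)
    moreover have "inf y (inf s w) \<le> inf y w"
      by (simp add: le_infI2)
    ultimately have "inf y (inf s w) \<le> b"
      by (rule order_trans[rotated])
    then show "inf y (inf s w) = inf s b"
      using y' w(3) by (intro antisym) (auto intro: le_infI1 le_infI2)
    have "sup y (inf s w) = inf s (sup y w)"
      using y' by (simp add: modular_sup_inf)
    also have "sup y w = b'"
      using w by (metis sup.absorb2 sup_assoc sup_commute)
    finally show "sup y (inf s w) = inf s b'" .
  qed (use y' in simp)
qed

text \<open>In the language of extensions: the sub \<open>q\<close> splits off from the parts of \<open>[x, x']\<close>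
  below \<open>r\<close> and below \<open>sup q (inf s b')\<close>; as \<open>[q, s]\<close> is semisimple,
  it therefore splits off from their join.\<close>

lemma complement_of_induced_filtration:
  fixes p q r s b b' :: "'a::artinian_lattice"
  assumes order: "p \<le> q" "q \<le> r" "r \<le> s" "b \<le> b'"
    and pr: "complemented_interval p r"
    and qs: "complemented_interval q s"
    and bb: "complemented_interval b b'"
  shows "has_complement_in (sup p (inf q b)) (sup r (inf s b')) q"
proof -
  define x where "x = sup p (inf q b)"
  define Q where "Q = sup q (inf s b')"
  have x: "x \<le> q" "p \<le> x" "inf q b \<le> x"
    using order by (auto simp: x_def)
  have Q: "q \<le> Q" "Q \<le> s" "inf s b' \<le> Q"
    using order by (auto simp: Q_def)
  obtain y where y: "inf q y = p" "sup q y = r"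
    using complemented_intervalD[OF pr, of q] order by (auto elim!: has_complement_inE)
  \<comment> \<open>\<open>z\<close> splits the trace of \<open>q\<close> off the layer from
    \<open>inf s b\<close> to \<open>inf s b'\<close>.\<close>
  obtain z where z: "inf (sup (inf q b') (inf s b)) z = inf s b"
      "sup (sup (inf q b') (inf s b)) z = inf s b'" "inf s b \<le> z" "z \<le> inf s b'"
    using complemented_intervalD[OF complemented_interval_inf[OF bb order(4), of s],
        of "sup (inf q b') (inf s b)"] order
    by (auto elim!: has_complement_inE intro: le_infI1 le_infI2 order_trans)
  obtain Q' where Q': "inf (inf r Q) Q' = q" "sup (inf r Q) Q' = Q" "q \<le> Q'" "Q' \<le> Q"
    using complemented_intervalD[OF complemented_subinterval[OF qs order_refl Q(2)], of "inf r Q"]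
      order Q by (auto elim!: has_complement_inE)
  have "inf q z = inf (inf q b') z"
    using z(4) by (metis inf.absorb2 inf_assoc le_inf_iff)
  also have "\<dots> \<le> inf (sup (inf q b') (inf s b)) z"
    by (meson inf_mono order_refl sup_ge1)
  finally have "inf q z \<le> inf s b"
    using z(1) by simp
  then have qz: "inf q z \<le> x"
    using x(3) by (meson inf_le1 inf_le2 le_inf_iff order_trans)
  have sqz: "sup q z = Q"
  proof (rule antisym)
    have "inf s b' \<le> sup q z"
      unfolding z(2)[symmetric] using z(3) by (auto intro: le_infI1 le_supI2 le_supI1)
    then show "Q \<le> sup q z"
      by (simp add: Q_def)
  qed (use z(4) Q in \<open>auto simp: Q_def intro: le_supI2\<close>)
  \<comment> \<open>\<open>sup x z\<close> may meet \<open>r\<close> outside \<open>q\<close>.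
    Cutting with \<open>Q'\<close>, which meets \<open>inf r Q\<close> only in \<open>q\<close>,
    removes this overlap, while \<open>sup q z'\<close> is still all of \<open>Q'\<close>.\<close>
  define z' where "z' = inf (sup x z) Q'"
  have z'q: "inf q z' \<le> x"
  proof -
    have "inf q z' \<le> inf (sup x z) q"
      unfolding z'_def by (simp add: le_infI2)
    also have "\<dots> = sup x (inf q z)"
      using x by (simp add: modular_sup_inf inf_commute)
    finally show ?thesis
      using qz by (simp add: sup_absorb1)
  qed
  have qz': "sup q z' = Q'"
  proof -
    have "sup q z' = inf (sup q (sup x z)) Q'"
      unfolding z'_def using Q' by (simp add: modular_sup_inf)
    also have "sup q (sup x z) = Q"
      using sqz x by (metis sup.absorb1 sup_assoc)
    finally show ?thesis
      using Q' by (simp add: inf_absorb2)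
  qed
  \<comment> \<open>The splitting below \<open>r\<close>, raised from \<open>p\<close> to the new
    bottom \<open>x\<close>. The complement sought is \<open>sup y' z'\<close>.\<close>
  define y' where "y' = sup x y"
  have y': "y' \<le> r" "inf q y' = x" "x \<le> y'" "sup q y' = r"
  proof -
    have "x \<le> r" "y \<le> r"
      using x(1) order(2) y(2) by auto
    then show "y' \<le> r" "x \<le> y'"
      unfolding y'_def by auto
    show "inf q y' = x"
      unfolding y'_def using x y by (simp add: modular_sup_inf sup_absorb1)
    show "sup q y' = r"
      unfolding y'_def using x y by (metis sup.absorb1 sup_assoc)
  qed
  have "has_complement_in x (sup r (inf s b')) q"
  proof (rule has_complement_inI)
    show "x \<le> q"
      by (rule x)
    have "inf r z' \<le> inf (inf r Q) Q'"
      using Q'(4) unfolding z'_def by (auto intro: le_infI1 le_infI2 order_trans)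
    then have "inf r z' \<le> inf q z'"
      using Q'(1) by simp
    then have "inf r z' \<le> y'"
      using order_trans[OF z'q y'(3)] by (rule order_trans)
    moreover have "inf r (sup y' z') = sup y' (inf r z')"
      using y' by (simp add: modular_sup_inf)
    ultimately have "inf r (sup y' z') = y'"
      by (simp add: sup_absorb1)
    then have "inf q (sup y' z') = inf q y'"
      using order(2) by (metis inf.absorb1 inf_assoc)
    then show "inf q (sup y' z') = x"
      using y' by simp
    have "sup q (sup y' z') = sup (sup q y') (sup q z')"
      by (simp add: sup_aci)
    also have "\<dots> = sup r Q'"
      using y' qz' by simp
    also have "\<dots> = sup r (sup (inf r Q) Q')"
      by (simp add: sup_assoc[symmetric] sup_absorb1)
    also have "\<dots> = sup r (inf s b')"
      using Q' order by (simp add: Q_def sup_assoc[symmetric] sup_absorb1)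
    finally show "sup q (sup y' z') = sup r (inf s b')" .
  qed
  then show ?thesis
    by (simp add: x_def)
qed

text \<open>The thresholds in \<open>b\<close> move in parallel with the index in \<open>a\<close>,
  so passing from \<open>t\<close> to \<open>t + 1\<close> involves one window of \<open>b\<close>
  and the two windows of \<open>a\<close> bounded by its \<open>fminus\<close> and by its
  \<open>fplus\<close> values.\<close>

lemma induced_in_Lambda:
  assumes "para_filtration a" "para_filtration b"
  shows "(\<lambda>t. sup (fminus a t) (inf (fplus a t) (fplus b (t + d)))) \<in> Lambda a"
proof -
  interpret A: para_filtration a by fact
  interpret B: para_filtration b by fact
  have "has_complement_in (sup (fminus a t) (inf (fplus a t) (fplus b (t + d))))
     (sup (fminus a (t + 1)) (inf (fplus a (t + 1)) (fplus b (t + 1 + d)))) (fplus a t)" for t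
  proof (rule complement_of_induced_filtration)
    show "complemented_interval (fplus b (t + d)) (fplus b (t + 1 + d))"
      using B.para_plus[of "t + d"] by (simp add: ac_simps)
  qed (simp_all add: A.minus_le_plus A.plus_le_minus B.plus_mono A.para_plus A.para_minus)
  then show ?thesis
    using A.minus_le_plus by (simp add: Lambda_def)
qed

text \<open>Abel summation: the sum of \<open>(c - d i) * q i\<close> over a sublevel set is an
  integral of sublevel sums up to \<open>c\<close>, hence nonpositive. It is obtained by descending
  from \<open>c\<close> to the next smaller value \<open>m\<close> of \<open>d\<close>; in the end
  \<open>c\<close> is taken above all values.\<close>

lemma sum_mult_nonneg_if_partial_sums_nonpos:
  fixes d q :: "'i \<Rightarrow> real"
  assumes "finite I" "\<And>c. (\<Sum>i\<in>{i\<in>I. d i \<le> c}. q i) \<le> 0" "sum q I = 0"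
  shows "0 \<le> (\<Sum>i\<in>I. d i * q i)"
proof -
  have *: "(\<Sum>i\<in>{i\<in>I. d i \<le> c}. (c - d i) * q i) \<le> 0" for c
  proof (induction "card {i\<in>I. d i < c}" arbitrary: c rule: less_induct)
    case less
    have "(\<Sum>i\<in>{i\<in>I. d i \<le> c}. (c - d i) * q i) = (\<Sum>i\<in>{i\<in>I. d i < c}. (c - d i) * q i)"
      using assms(1) by (intro sum.mono_neutral_right) auto
    also have "\<dots> \<le> 0"
    proof (cases "{i\<in>I. d i < c} = {}")
      case False
      define m where "m = Max (d ` {i\<in>I. d i < c})"
      have "m \<in> d ` {i\<in>I. d i < c}"
        unfolding m_def using assms(1) False by (intro Max_in) auto
      then obtain k where k: "k \<in> I" "d k < c" "m = d k"
        by auto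
      have m: "d i \<le> m" if "i \<in> I" "d i < c" for i
        unfolding m_def using assms(1) that by (intro Max_ge) auto
      have eq: "{i\<in>I. d i < c} = {i\<in>I. d i \<le> m}"
        using k m by auto
      have "{i\<in>I. d i < m} \<subset> {i\<in>I. d i < c}"
        using k by auto
      then have IH: "(\<Sum>i\<in>{i\<in>I. d i \<le> m}. (m - d i) * q i) \<le> 0"
        using assms(1) by (intro less.hyps psubset_card_mono) auto
      have "(\<Sum>i\<in>{i\<in>I. d i < c}. (c - d i) * q i)
          = (c - m) * (\<Sum>i\<in>{i\<in>I. d i \<le> m}. q i) + (\<Sum>i\<in>{i\<in>I. d i \<le> m}. (m - d i) * q i)"
        unfolding eq sum_distrib_left sum.distrib[symmetric]
        by (intro sum.cong refl) (simp add: algebra_simps)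
      also have "\<dots> \<le> 0"
        using IH assms(2)[of m] k by (intro add_nonpos_nonpos mult_nonneg_nonpos) auto
      finally show ?thesis .
    next
      case True
      then show ?thesis
        by (simp only: sum.empty order_refl)
    qed
    finally show ?case .
  qed
  define D where "D = Max (insert 0 (d ` I))"
  have "{i\<in>I. d i \<le> D} = I"
    using assms(1) by (auto simp: D_def)
  then have "(\<Sum>i\<in>I. (D - d i) * q i) \<le> 0"
    using *[of D] by simp
  also have "(\<Sum>i\<in>I. (D - d i) * q i) = D * sum q I - (\<Sum>i\<in>I. d i * q i)"
    by (simp add: left_diff_distrib sum_subtractf sum_distrib_left)
  finally show ?thesis
    using assms(3) by simp
qed

section \<open>Comparison of two filtrations through their common refinement\<close>

context strict_valuation
begin

text \<open>The size of the piece of the common refinement of \<open>a\<close> and \<open>b\<close>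
  that has weight \<open>s\<close> in \<open>a\<close> and weight \<open>t\<close> in \<open>b\<close>.\<close>

definition bijump :: "'a filtration \<Rightarrow> 'a filtration \<Rightarrow> real \<Rightarrow> real \<Rightarrow> real" where
  "bijump a b s t = v (inf (fplus a s) (fplus b t)) - v (inf (fminus a s) (fplus b t))
     - (v (inf (fplus a s) (fminus b t)) - v (inf (fminus a s) (fminus b t)))"

lemma bijump_commute: "bijump b a t s = bijump a b s t"
  by (simp add: bijump_def inf_commute)

text \<open>By \<open>v_zassenhaus\<close> it is the increment at \<open>t\<close> of the filtration
  that \<open>b\<close> induces on the part of \<open>a\<close> at \<open>s\<close>.\<close>

lemma bijump_nonneg:
  assumes "para_filtration a" "para_filtration b"
  shows "0 \<le> bijump a b s t"
proof -
  interpret A: para_filtration a by fact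
  interpret B: para_filtration b by fact
  have "v (sup (fminus a s) (inf (fplus a s) (fminus b t)))
      \<le> v (sup (fminus a s) (inf (fplus a s) (fplus b t)))"
    by (intro mono_v sup_mono inf_mono order_refl B.minus_le_plus)
  then show ?thesis
    unfolding bijump_def v_zassenhaus[OF A.minus_le_plus, symmetric] by simp
qed

lemma sum_bijump:
  assumes "para_filtration b"
  shows "(\<Sum>t\<in>{t\<in>supp b. t \<le> u}. bijump a b s t)
    = v (inf (fplus a s) (fplus b u)) - v (inf (fminus a s) (fplus b u))"
proof -
  interpret B: para_filtration b by fact
  show ?thesis
    using B.sum_jumps[of "\<lambda>x. v (inf (fplus a s) x) - v (inf (fminus a s) x)" u]
    by (simp add: bijump_def inf_absorb2)
qed

lemma sum_bijump_supp:
  assumes "para_filtration b"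
  shows "(\<Sum>t\<in>supp b. bijump a b s t) = v (fplus a s) - v (fminus a s)"
proof -
  interpret B: para_filtration b by fact
  define u where "u = Max (insert 0 (supp b))"
  have u: "t \<le> u" if "t \<in> supp b" for t
    using that B.finite_S by (simp add: u_def)
  then have "{t\<in>supp b. t \<le> u} = supp b" "supp b \<inter> {u<..} = {}"
    by force+
  then show ?thesis
    using sum_bijump[OF assms, where u = u and a = a and s = s] B.no_jump_above[of u] by (simp add: inf_absorb1)
qed

text \<open>With \<open>t - s\<close> as level function, each sublevel sum of
  \<open>s * bijump a b s t\<close> is the sum in the semistability inequality for an induced
  element of \<open>Lambda a\<close>, and the total vanishes by phase zero. Abel summation
  applies.\<close>

lemma sum_bijump_weights_nonneg:
  assumes a: "para_filtration a" and b: "para_filtration b" and "phase_zero_semistable v a"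
  shows "0 \<le> (\<Sum>(s, t)\<in>supp a \<times> supp b. (t - s) * (s * bijump a b s t))"
proof -
  interpret A: para_filtration a by fact
  interpret B: para_filtration b by fact
  have fin: "finite (supp a \<times> supp b)"
    using A.finite_S B.finite_S by simp
  have "(\<Sum>p\<in>{p\<in>supp a \<times> supp b. snd p - fst p \<le> c}. fst p * bijump a b (fst p) (snd p)) \<le> 0" for c
  proof -
    let ?x = "\<lambda>t. sup (fminus a t) (inf (fplus a t) (fplus b (t + c)))"
    have "{p\<in>supp a \<times> supp b. snd p - fst p \<le> c} = (SIGMA s:supp a. {t\<in>supp b. t \<le> s + c})"
      by auto
    then have "(\<Sum>p\<in>{p\<in>supp a \<times> supp b. snd p - fst p \<le> c}. fst p * bijump a b (fst p) (snd p))
       = (\<Sum>s\<in>supp a. \<Sum>t\<in>{t\<in>supp b. t \<le> s + c}. s * bijump a b s t)"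
      using A.finite_S B.finite_S by (subst sum.Sigma) (auto simp: case_prod_unfold)
    also have "\<dots> = (\<Sum>s\<in>supp a. s * (v (?x s) - v (fminus a s)))"
      by (simp add: sum_distrib_left[symmetric] sum_bijump[OF b] v_zassenhaus[OF A.minus_le_plus])
    also have "\<dots> \<le> 0"
      using bspec[OF conjunct1[OF assms(3)[unfolded phase_zero_semistable_def]] induced_in_Lambda[OF a b, of c]]
      by simp
    finally show ?thesis .
  qed
  moreover have "(\<Sum>p\<in>supp a \<times> supp b. fst p * bijump a b (fst p) (snd p)) = 0"
  proof -
    have "(\<Sum>p\<in>supp a \<times> supp b. fst p * bijump a b (fst p) (snd p))
        = (\<Sum>s\<in>supp a. s * (\<Sum>t\<in>supp b. bijump a b s t))"
      by (simp add: sum.cartesian_product case_prod_unfold sum_distrib_left)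
    also have "\<dots> = (\<Sum>s\<in>supp a. s * (v (fplus a s) - v (fminus a s)))"
      by (simp add: sum_bijump_supp[OF b])
    also have "\<dots> = 0"
      using assms(3) unfolding phase_zero_semistable_def by blast
    finally show ?thesis .
  qed
  ultimately have "0 \<le> (\<Sum>p\<in>supp a \<times> supp b. (snd p - fst p) * (fst p * bijump a b (fst p) (snd p)))"
    by (intro sum_mult_nonneg_if_partial_sums_nonpos fin)
  then show ?thesis
    by (simp add: case_prod_unfold)
qed

lemma bijump_eq_0:
  assumes a: "para_filtration a" "phase_zero_semistable v a"
    and b: "para_filtration b" "phase_zero_semistable v b"
    and st: "s \<in> supp a" "t \<in> supp b" "s \<noteq> t"
  shows "bijump a b s t = 0"
proof -
  interpret A: para_filtration a by fact
  interpret B: para_filtration b by fact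
  have fin: "finite (supp a \<times> supp b)"
    using A.finite_S B.finite_S by simp
  have "(\<Sum>(t, s)\<in>supp b \<times> supp a. (s - t) * (t * bijump b a t s))
      = (\<Sum>(s, t)\<in>supp a \<times> supp b. (s - t) * (t * bijump a b s t))"
    by (rule sum.reindex_bij_witness[of _ prod.swap prod.swap]) (auto simp: bijump_commute)
  then have "0 \<le> (\<Sum>(s, t)\<in>supp a \<times> supp b. (t - s) * (s * bijump a b s t))
      + (\<Sum>(s, t)\<in>supp a \<times> supp b. (s - t) * (t * bijump a b s t))"
    using sum_bijump_weights_nonneg[OF a(1) b(1) a(2)] sum_bijump_weights_nonneg[OF b(1) a(1) b(2)]
    by simp
  \<comment> \<open>The coefficients combine as
    \<open>(t - s) * s + (s - t) * t = - (s - t)^2\<close>.\<close>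
  also have "\<dots> = - (\<Sum>(s, t)\<in>supp a \<times> supp b. (s - t)\<^sup>2 * bijump a b s t)"
    unfolding sum.distrib[symmetric] sum_negf[symmetric]
    by (intro sum.cong refl) (auto simp: power2_eq_square algebra_simps)
  finally have "(\<Sum>(s, t)\<in>supp a \<times> supp b. (s - t)\<^sup>2 * bijump a b s t) \<le> 0"
    by simp
  moreover have nonneg: "0 \<le> (case p of (s, t) \<Rightarrow> (s - t)\<^sup>2 * bijump a b s t)" for p
    using bijump_nonneg[OF a(1) b(1)] by (simp add: case_prod_unfold)
  ultimately have "(\<Sum>(s, t)\<in>supp a \<times> supp b. (s - t)\<^sup>2 * bijump a b s t) = 0"
    by (intro antisym sum_nonneg) auto
  then have "\<forall>p\<in>supp a \<times> supp b. (case p of (s, t) \<Rightarrow> (s - t)\<^sup>2 * bijump a b s t) = 0"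
    using sum_nonneg_eq_0_iff[OF fin nonneg] by simp
  then show ?thesis
    using st by auto
qed

lemma fplus_le_if_phase_zero:
  assumes a: "para_filtration a" "phase_zero_semistable v a"
    and b: "para_filtration b" "phase_zero_semistable v b"
  shows "fplus a u \<le> fplus b u"
proof -
  interpret A: para_filtration a by fact
  interpret B: para_filtration b by fact
  have "v (fplus a u) - v lbot = (\<Sum>s\<in>{s\<in>supp a. s \<le> u}. v (fplus a s) - v (fminus a s))"
    by (rule A.sum_jumps[symmetric])
  also have "\<dots> = (\<Sum>s\<in>{s\<in>supp a. s \<le> u}. \<Sum>t\<in>supp b. bijump a b s t)"
    by (simp add: sum_bijump_supp[OF b(1)])
  \<comment> \<open>A piece with \<open>s \<le> u < t\<close> is off the diagonal and has size zero.
    So meeting with \<open>fplus b u\<close> costs \<open>fplus a u\<close> nothing, and strictness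
    of \<open>v\<close> gives the inclusion.\<close>
  also have "\<dots> = (\<Sum>s\<in>{s\<in>supp a. s \<le> u}. \<Sum>t\<in>{t\<in>supp b. t \<le> u}. bijump a b s t)"
    using B.finite_S bijump_eq_0[OF a b] by (intro sum.cong refl sum.mono_neutral_right) auto
  also have "\<dots> = (\<Sum>s\<in>{s\<in>supp a. s \<le> u}. v (inf (fplus a s) (fplus b u)) - v (inf (fminus a s) (fplus b u)))"
    by (simp add: sum_bijump[OF b(1)])
  also have "\<dots> = v (inf (fplus a u) (fplus b u)) - v lbot"
    using A.sum_jumps[of "\<lambda>x. v (inf x (fplus b u))" u] by (simp add: inf_absorb1)
  finally have "inf (fplus a u) (fplus b u) = fplus a u"
    by (intro eq_if_v_le) auto
  then show ?thesis
    by (simp add: inf.absorb_iff1)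
qed

lemma phase_zero_unique:
  assumes a: "para_filtration a" "phase_zero_semistable v a"
    and b: "para_filtration b" "phase_zero_semistable v b"
  shows "a = b"
proof -
  interpret A: para_filtration a by fact
  interpret B: para_filtration b by fact
  have plus: "fplus a t = fplus b t" for t
    by (intro antisym fplus_le_if_phase_zero a b)
  have "fminus a t = fminus b t" for t
  proof -
    obtain e where e: "0 < e" "\<And>d. 0 < d \<Longrightarrow> d \<le> e \<Longrightarrow> (supp a \<union> supp b) \<inter> {t - d..<t} = {}"
      using gap_below[of "supp a \<union> supp b"] A.finite_S B.finite_S by blast
    then have "(supp a \<union> supp b) \<inter> {t - e..<t} = {}"
      by simp
    then have "supp a \<inter> {t - e<..<t} = {}" "supp b \<inter> {t - e<..<t} = {}"
      by force+
    then show ?thesis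
      using A.no_jump_between[of "t - e" t] B.no_jump_between[of "t - e" t] e(1) plus by simp
  qed
  with plus show ?thesis
    by (intro prod_eqI ext) auto
qed

end

section \<open>Existence\<close>

text \<open>Positive weights make the sublevel sets bounded in each coordinate of \<open>I\<close>,
  so the minimum may be sought in a product of compact intervals. Pinning the other coordinates to
  \<open>0\<close> keeps this product compact in the full function space.\<close>

lemma weighted_squares_attain_min:
  fixes F :: "('i \<Rightarrow> real) set" and w :: "'i \<Rightarrow> real"
  assumes "finite I" and w: "\<And>i. i \<in> I \<Longrightarrow> 0 < w i"
    and "closed F" "F \<noteq> {}" and supp: "\<And>l i. l \<in> F \<Longrightarrow> i \<notin> I \<Longrightarrow> l i = 0"
  shows "\<exists>l\<in>F. \<forall>l'\<in>F. (\<Sum>i\<in>I. w i * (l i)\<^sup>2) \<le> (\<Sum>i\<in>I. w i * (l' i)\<^sup>2)"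
proof -
  let ?E = "\<lambda>l. \<Sum>i\<in>I. w i * (l i)\<^sup>2"
  obtain l0 where l0: "l0 \<in> F"
    using assms(4) by blast
  \<comment> \<open>The largest size of coordinate \<open>i\<close> for which its term alone does
    not exceed the value at \<open>l0\<close>.\<close>
  define M where "M i = (if i \<in> I then sqrt (?E l0 / w i) else 0)" for i
  define box where "box = Pi\<^sub>E UNIV (\<lambda>i. {- M i..M i})"
  have in_box: "l \<in> box" if "l \<in> F" "?E l \<le> ?E l0" for l
  proof -
    have "\<bar>l i\<bar> \<le> M i" for i
    proof (cases "i \<in> I")
      case True
      have "w i * (l i)\<^sup>2 \<le> ?E l"
        using assms(1) True less_imp_le[OF w] by (intro member_le_sum) auto
      then have "(l i)\<^sup>2 \<le> ?E l0 / w i"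
        using that(2) w[OF True] by (simp add: field_simps)
      then have "sqrt ((l i)\<^sup>2) \<le> sqrt (?E l0 / w i)"
        by (rule real_sqrt_le_mono)
      then show ?thesis
        using True by (simp add: M_def)
    qed (use supp that in \<open>simp add: M_def\<close>)
    then show ?thesis
      by (auto simp: box_def abs_le_iff minus_le_iff)
  qed
  have "compact box"
    unfolding box_def compactin_euclidean_iff[symmetric] euclidean_product_topology[symmetric]
    by (subst compactin_PiE) simp
  then have "compact (F \<inter> box)"
    using assms(3) by (simp add: closed_Int_compact)
  moreover have "l0 \<in> F \<inter> box"
    using l0 in_box by blast
  moreover have "continuous_on (F \<inter> box) ?E"
    by (intro continuous_intros continuous_on_subset[OF continuous_on_product_coordinates]) auto
  ultimately obtain l where l: "l \<in> F \<inter> box" "\<And>l'. l' \<in> F \<inter> box \<Longrightarrow> ?E l \<le> ?E l'"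
    using continuous_attains_inf[of "F \<inter> box" ?E] by blast
  have "?E l \<le> ?E l'" if "l' \<in> F" for l'
  proof (cases "?E l' \<le> ?E l0")
    case True
    then show ?thesis
      using l(2)[of l'] in_box that by blast
  next
    case False
    then show ?thesis
      using l(2)[OF \<open>l0 \<in> F \<inter> box\<close>] by linarith
  qed
  then show ?thesis
    using l(1) by blast
qed

text \<open>The first-order test: a second-order expansion divided by its parameter \<open>e\<close>
  leaves such a bound, and the right side disappears as \<open>e\<close> tends to
  \<open>0\<close>.\<close>

lemma nonpos_if_le_small_multiples:
  fixes A C e0 :: real
  assumes "0 < e0" "\<And>e. 0 < e \<Longrightarrow> e < e0 \<Longrightarrow> A \<le> e * C"
  shows "A \<le> 0"
proof (rule ccontr)
  assume "\<not> A \<le> 0"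
  then have "0 < A" by simp
  moreover have "A \<le> e0 / 2 * C"
    using assms(2)[of "e0 / 2"] assms(1) by simp
  ultimately have "0 < C"
    using assms(1) by (smt (verit) half_gt_zero mult_nonneg_nonpos)
  define e where "e = min (e0 / 2) (A / (2 * C))"
  have "A \<le> e * C"
    using assms \<open>0 < A\<close> \<open>0 < C\<close> by (intro assms(2)) (auto simp: e_def)
  also have "\<dots> \<le> A / (2 * C) * C"
    using \<open>0 < C\<close> by (intro mult_right_mono) (auto simp: e_def)
  finally show False
    using \<open>0 < A\<close> \<open>0 < C\<close> by simp
qed

lemma finite_min_gap:
  fixes T :: "real set"
  assumes "finite T"
  obtains e where "0 < e" "\<And>s t. s \<in> T \<Longrightarrow> t \<in> T \<Longrightarrow> s < t \<Longrightarrow> s + e < t"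
proof -
  \<comment> \<open>The \<open>1\<close> keeps the set nonempty when \<open>T\<close> has no two
    distinct points; half of the minimum yields the strict inequality.\<close>
  let ?D = "insert 1 {d\<in>(\<lambda>(s, t). t - s) ` (T \<times> T). 0 < d}"
  have fin: "finite ?D"
    using assms by simp
  have "Min ?D \<in> ?D"
    using fin by (intro Min_in) auto
  then have "0 < Min ?D"
    by auto
  moreover have "Min ?D \<le> t - s" if "s \<in> T" "t \<in> T" "s < t" for s t
    using fin that by (intro Min_le) force+
  ultimately show ?thesis
    using that[of "Min ?D / 2"] by force
qed

text \<open>A composition series with integer weights: each half-open window of length one contains
  at most one step, and such a step has only its two ends as elements.\<close>

lemma B_filtrations_nonempty: "(B_filtrations :: 'a::artinian_lattice filtration set) \<noteq> {}"
proof -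
  obtain c :: "nat \<Rightarrow> 'a" and N where c: "c 0 = lbot" "c N = ltop" "mono c"
    "\<And>i z. c i \<le> z \<Longrightarrow> z \<le> c (Suc i) \<Longrightarrow> z = c i \<or> z = c (Suc i)"
    using composition_series by blast
  have cover: "complemented_interval (c i) (c (Suc i))" for i
    unfolding complemented_interval_def has_complement_in_def
    using c(4)[of i] monoD[OF c(3), of i "Suc i"]
    by (metis atLeastAtMost_iff inf.absorb1 inf.absorb2 le_SucI order_refl sup.absorb1 sup.absorb2)
  interpret filtration_jumps "real ` {1..N}" "step_filtration N real c"
    using c by (intro jumps_step_filtration) (auto simp: mono_on_def mono_def)
  have "paracomplemented (step_filtration N real c)"
  proof (rule paracomplemented_step_filtration)
    show "real j - real (Suc i) \<ge> 1" if "i < j" "\<not> complemented_interval (c i) (c j)" for i j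
    proof -
      have "j \<noteq> Suc i"
        using that cover by auto
      then show ?thesis
        using that by linarith
    qed
  qed (auto simp: mono_on_def)
  then show ?thesis
    using R_filtration unfolding B_filtrations_def by blast
qed

section \<open>Minimisation of the energy over all paracomplemented filtrations\<close>

context strict_valuation
begin

definition energy :: "'a filtration \<Rightarrow> real" where
  "energy a = (\<Sum>t\<in>supp a. t\<^sup>2 * (v (fplus a t) - v (fminus a t)))"

lemma energy_jumps:
  assumes "filtration_jumps S a"
  shows "energy a = (\<Sum>t\<in>S. t\<^sup>2 * (v (fplus a t) - v (fminus a t)))"
proof -
  interpret filtration_jumps S a by fact
  show ?thesis
    unfolding energy_def
    by (rule sum.mono_neutral_left) (use finite_S supp_subset in \<open>auto simp: supp_def\<close>)
qed

text \<open>The steps sharing a weight \<open>t\<close> are consecutive and their sizes telescope to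
  the jump at \<open>t\<close>; the sum over jumps is then regrouped by the fibres of
  \<open>l\<close>.\<close>

lemma energy_step_filtration:
  assumes l: "mono_on {1..n} l" and "mono_on {0..n} c" "c 0 = lbot" "c n = ltop"
  shows "energy (step_filtration n l c) = (\<Sum>i=1..n. (v (c i) - v (c (i - 1))) * (l i)\<^sup>2)"
proof -
  have "(v (c (card {j\<in>{1..n}. l j \<le> t})) - v (c (card {j\<in>{1..n}. l j < t})))
      = (\<Sum>i\<in>{i\<in>{1..n}. l i = t}. v (c i) - v (c (i - 1)))" for t
  proof -
    let ?i = "card {j\<in>{1..n}. l j < t}" and ?j = "card {j\<in>{1..n}. l j \<le> t}"
    have "{i\<in>{1..n}. l i = t} = {Suc ?i..?j}"
    proof (intro equalityI subsetI)
      fix i assume "i \<in> {i\<in>{1..n}. l i = t}"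
      then show "i \<in> {Suc ?i..?j}"
        using le_card_le_iff[OF l, of i t] le_card_less_iff[OF l, of i t] by auto
    next
      fix i assume i: "i \<in> {Suc ?i..?j}"
      moreover have "?j \<le> n"
        by (rule card_prefix_le)
      ultimately have "1 \<le> i" "i \<le> n"
        by auto
      then show "i \<in> {i\<in>{1..n}. l i = t}"
        using i le_card_le_iff[OF l, of i t] le_card_less_iff[OF l, of i t] by auto
    qed
    moreover have "?i \<le> ?j"
      by (rule card_mono) auto
    ultimately show ?thesis
      by (simp only: sum_telescope''[of _ _ "\<lambda>i. v (c i)"])
  qed
  note jump = this
  have "energy (step_filtration n l c) = (\<Sum>t\<in>l ` {1..n}. t\<^sup>2 *
      (v (c (card {j\<in>{1..n}. l j \<le> t})) - v (c (card {j\<in>{1..n}. l j < t}))))"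
    unfolding energy_jumps[OF jumps_step_filtration[OF assms(2-4)]] by (simp add: step_filtration_def)
  also have "\<dots> = (\<Sum>t\<in>l ` {1..n}. \<Sum>i\<in>{i\<in>{1..n}. l i = t}. (v (c i) - v (c (i - 1))) * (l i)\<^sup>2)"
    unfolding jump sum_distrib_left by (intro sum.cong refl) auto
  also have "\<dots> = (\<Sum>i=1..n. (v (c i) - v (c (i - 1))) * (l i)\<^sup>2)"
    by (rule sum.image_gen[symmetric]) simp
  finally show ?thesis .
qed

text \<open>The part of a chain that determines which weights are admissible for it and the
  energies of the resulting filtrations.\<close>

definition profile :: "nat \<Rightarrow> (nat \<Rightarrow> 'a) \<Rightarrow> nat \<times> (nat \<Rightarrow> real) \<times> (nat \<times> nat) set" where
  "profile n c = (n, restrict (\<lambda>i. v (c i) - v (c (i - 1))) {1..n},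
     {(i, j). i < j \<and> j \<le> n \<and> \<not> complemented_interval (c i) (c j)})"

definition full_chain :: "nat \<Rightarrow> (nat \<Rightarrow> 'a) \<Rightarrow> bool" where
  "full_chain n c \<longleftrightarrow> strict_mono_on {0..n} c \<and> c 0 = lbot \<and> c n = ltop"

fun weights :: "nat \<times> (nat \<Rightarrow> real) \<times> (nat \<times> nat) set \<Rightarrow> (nat \<Rightarrow> real) set" where
  "weights (n, w, P) = {l. (\<forall>i. i \<notin> {1..n} \<longrightarrow> l i = 0) \<and>
     (\<forall>i j. 1 \<le> i \<longrightarrow> i \<le> j \<longrightarrow> j \<le> n \<longrightarrow> l i \<le> l j) \<and> (\<forall>(i, j)\<in>P. 1 \<le> l j - l (Suc i))}"

fun weights_energy :: "nat \<times> (nat \<Rightarrow> real) \<times> (nat \<times> nat) set \<Rightarrow> (nat \<Rightarrow> real) \<Rightarrow> real" where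
  "weights_energy (n, w, P) l = (\<Sum>i=1..n. w i * (l i)\<^sup>2)"

text \<open>Lengths are bounded, step sizes are differences of the finitely many values of
  \<open>v\<close>, and the pairs lie in a finite grid. Restricting the size function to
  \<open>{1..n}\<close> makes finiteness of the function space available.\<close>

lemma finite_profiles: "finite {profile n c | n c. full_chain n c}"
proof -
  obtain N where N: "\<And>n c::nat \<Rightarrow> 'a. (\<And>i. i < n \<Longrightarrow> c i < c (Suc i)) \<Longrightarrow> n \<le> N"
    using finite_length by metis
  define V where "V = (\<lambda>(x, y). x - y) ` (range v \<times> range v)"
  have "finite V"
    unfolding V_def using finite_range_v by simp
  have "profile n c \<in> (SIGMA n:{..N}. ({1..n} \<rightarrow>\<^sub>E V) \<times> Pow ({..n} \<times> {..n}))" if "full_chain n c" for n c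
  proof -
    have "n \<le> N"
      using that by (intro N[of n c]) (auto simp: full_chain_def strict_mono_on_def)
    then show ?thesis
      by (auto simp: profile_def V_def)
  qed
  then have "{profile n c | n c. full_chain n c} \<subseteq> (SIGMA n:{..N}. ({1..n} \<rightarrow>\<^sub>E V) \<times> Pow ({..n} \<times> {..n}))"
    by blast
  then show ?thesis
    by (rule finite_subset) (use \<open>finite V\<close> in \<open>auto intro!: finite_SigmaI finite_PiE\<close>)
qed

lemma weights_energy_attains_min:
  assumes "full_chain n c" "weights (profile n c) \<noteq> {}"
  shows "\<exists>l\<in>weights (profile n c). \<forall>l'\<in>weights (profile n c).
     weights_energy (profile n c) l \<le> weights_energy (profile n c) l'"
proof -
  obtain w P where p: "profile n c = (n, w, P)"
    by (simp add: profile_def)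
  have w: "0 < w i" if "i \<in> {1..n}" for i
    using assms(1) p that by (auto simp: profile_def full_chain_def strict_mono_on_def intro!: strict)
  have "closed (weights (n, w, P))"
    unfolding weights.simps case_prod_unfold Ball_def
    by (intro closed_Collect_conj closed_Collect_all closed_Collect_imp open_Collect_const
        closed_Collect_eq closed_Collect_le continuous_intros continuous_on_product_coordinates)
  then show ?thesis
    using assms(2) w unfolding p weights_energy.simps
    by (intro weighted_squares_attain_min) auto
qed

lemma filtration_of_weights:
  assumes "full_chain n c" "l \<in> weights (profile n c)"
  shows "step_filtration n l c \<in> B_filtrations"
    "energy (step_filtration n l c) = weights_energy (profile n c) l"
proof -
  have l: "mono_on {1..n} l"
    "\<And>i j. i < j \<Longrightarrow> j \<le> n \<Longrightarrow> \<not> complemented_interval (c i) (c j) \<Longrightarrow> l j - l (Suc i) \<ge> 1"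
    using assms(2) by (auto simp: profile_def mono_on_def)
  have c: "mono_on {0..n} c" "c 0 = lbot" "c n = ltop"
    using assms(1) strict_mono_on_imp_mono_on by (auto simp: full_chain_def)
  interpret filtration_jumps "l ` {1..n}" "step_filtration n l c"
    using c by (rule jumps_step_filtration)
  show "step_filtration n l c \<in> B_filtrations"
    using R_filtration paracomplemented_step_filtration[OF l] by (simp add: B_filtrations_def)
  show "energy (step_filtration n l c) = weights_energy (profile n c) l"
    unfolding energy_step_filtration[OF l(1) c] by (simp add: profile_def)
qed

lemma weights_of_filtration:
  assumes "a \<in> B_filtrations"
  obtains n l c where "full_chain n c" "l \<in> weights (profile n c)"
    "energy a = weights_energy (profile n c) l"
proof -
  have "R_filtration a" "paracomplemented a"
    using assms by (auto simp: B_filtrations_def)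
  then obtain n l c where a: "a = step_filtration n l c" "strict_mono_on {1..n} l"
      "strict_mono_on {0..n} c" "c 0 = lbot" "c n = ltop"
    using R_filtration_imp_step by metis
  have mono: "mono_on {1..n} l" "mono_on {0..n} c"
    using a strict_mono_on_imp_mono_on by auto
  \<comment> \<open>Values of \<open>l\<close> outside \<open>{1..n}\<close> are arbitrary and do
    not affect the filtration, but \<open>weights\<close> requires them to be
    \<open>0\<close>.\<close>
  define l' where "l' i = (if i \<in> {1..n} then l i else 0)" for i
  show ?thesis
  proof (rule that)
    show "full_chain n c"
      using a by (simp add: full_chain_def)
    have "1 \<le> l j - l (Suc i)" if "i < j" "j \<le> n" "\<not> complemented_interval (c i) (c j)" for i j
      using step_filtration_paracomplementedD[OF mono _ that] \<open>paracomplemented a\<close> a by simp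
    then show "l' \<in> weights (profile n c)"
      using mono_onD[OF mono(1)] by (auto simp: profile_def l'_def)
    show "energy a = weights_energy (profile n c) l'"
      using a energy_step_filtration[OF mono] by (simp add: profile_def l'_def)
  qed
qed

text \<open>First the weights are minimised for each profile, then the finitely many minima are
  compared; the optimal weights can be put on any chain with the winning profile.\<close>

lemma energy_attains_min: "\<exists>a\<in>B_filtrations. \<forall>b\<in>B_filtrations. energy a \<le> energy b"
proof -
  define \<P> where "\<P> = {p. (\<exists>n c. full_chain n c \<and> p = profile n c) \<and> weights p \<noteq> {}}"
  have "finite \<P>"
    unfolding \<P>_def by (rule finite_subset[OF _ finite_profiles]) auto
  have "\<P> \<noteq> {}"
  proof -
    obtain a :: "'a filtration" where "a \<in> B_filtrations"
      using B_filtrations_nonempty by blast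
    then obtain n l c where "full_chain n c" "l \<in> weights (profile n c)"
      by (rule weights_of_filtration)
    then have "profile n c \<in> \<P>"
      unfolding \<P>_def by blast
    then show ?thesis
      by blast
  qed
  have "\<forall>p\<in>\<P>. \<exists>l\<in>weights p. \<forall>l'\<in>weights p. weights_energy p l \<le> weights_energy p l'"
    unfolding \<P>_def using weights_energy_attains_min by blast
  then obtain m where m: "\<And>p. p \<in> \<P> \<Longrightarrow> m p \<in> weights p"
      "\<And>p l. p \<in> \<P> \<Longrightarrow> l \<in> weights p \<Longrightarrow> weights_energy p (m p) \<le> weights_energy p l"
    by metis
  obtain p where p: "p \<in> \<P>" "\<And>q. q \<in> \<P> \<Longrightarrow> weights_energy p (m p) \<le> weights_energy q (m q)"
  proof -
    have "Min ((\<lambda>p. weights_energy p (m p)) ` \<P>) \<in> (\<lambda>p. weights_energy p (m p)) ` \<P>"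
      using \<open>finite \<P>\<close> \<open>\<P> \<noteq> {}\<close> by (intro Min_in) auto
    then obtain p where "p \<in> \<P>" "Min ((\<lambda>p. weights_energy p (m p)) ` \<P>) = weights_energy p (m p)"
      by blast
    then show ?thesis
      using that[of p] Min_le[of "(\<lambda>p. weights_energy p (m p)) ` \<P>"] \<open>finite \<P>\<close> by simp
  qed
  obtain n c where nc: "full_chain n c" "p = profile n c"
    using p(1) by (auto simp: \<P>_def)
  have "m p \<in> weights (profile n c)"
    using m(1)[OF p(1)] nc by simp
  note a = filtration_of_weights[OF nc(1) this]
  have "energy (step_filtration n (m p) c) \<le> energy b" if b: "b \<in> B_filtrations" for b
  proof -
    obtain k l d where kd: "full_chain k d" "l \<in> weights (profile k d)"
        "energy b = weights_energy (profile k d) l"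
      using weights_of_filtration[OF b] by blast
    have "profile k d \<in> \<P>"
      unfolding \<P>_def using kd by blast
    then have "weights_energy p (m p) \<le> energy b"
      using p(2) m(2) kd(2,3) order_trans by metis
    then show ?thesis
      using a(2) nc by simp
  qed
  then show ?thesis
    using a(1) by blast
qed

section \<open>Deformations of a filtration and the first-order conditions\<close>

text \<open>The weights of the part \<open>x\<close> are lowered by \<open>e\<close>. This is meaningful only if \<open>e\<close> is
  smaller than the gaps of \<open>S\<close>: then the intersections have at most one element.\<close>

definition lower_part :: "real set \<Rightarrow> 'a filtration \<Rightarrow> (real \<Rightarrow> 'a) \<Rightarrow> real \<Rightarrow> 'a filtration" where
  "lower_part S a x e =
     (\<lambda>t. if S \<inter> {t..<t + e} = {} then fminus a t else x (the_elem (S \<inter> {t..<t + e})),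
      \<lambda>t. if S \<inter> {t<..t + e} = {} then fplus a t else x (the_elem (S \<inter> {t<..t + e})))"

text \<open>For small \<open>e\<close>, a window of length one of the deformed filtration is either
  a window of \<open>a\<close> or an interval \<open>[x s, x (s + 1)]\<close>, which is complemented
  by \<open>complemented_Lambda\<close>.\<close>

lemma lower_part_in_B:
  assumes "para_filtration a" and x: "x \<in> Lambda a"
  obtains e0 where "0 < e0" "\<And>e. 0 < e \<Longrightarrow> e < e0 \<Longrightarrow>
    \<exists>b\<in>B_filtrations. energy b = energy a
      + (\<Sum>t\<in>supp a. ((t - e)\<^sup>2 - t\<^sup>2) * (v (x t) - v (fminus a t)))"
proof -
  interpret A: para_filtration a by fact
  define S where "S = supp a"
  have finS: "finite S"
    using A.finite_S by (simp add: S_def)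
  \<comment> \<open>Including the translates by one makes \<open>e\<close> smaller than every
    nonzero distance between \<open>S\<close> and its translates, so both ends of a window are
    affected at matching points.\<close>
  define T where "T = S \<union> (\<lambda>t. t - 1) ` S \<union> (\<lambda>t. t + 1) ` S"
  have "finite T"
    using finS by (simp add: T_def)
  then obtain e0 where e0: "0 < e0" "\<And>s t. s \<in> T \<Longrightarrow> t \<in> T \<Longrightarrow> s < t \<Longrightarrow> s + e0 < t"
    using finite_min_gap by metis
  show ?thesis
  proof (rule that[OF e0(1)])
    fix e assume e: "0 < e" "e < e0"
    have gap: "s + e < t" if "s \<in> T" "t \<in> T" "s < t" for s t
      using e0(2)[OF that] e by simp
    have ST: "s \<in> T" if "s \<in> S" for s
      using that by (simp add: T_def)
    note gapS = gap[OF ST ST]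
    have uniq: "u = s" if "u \<in> T" "s \<in> T" "s \<le> u + e" "u \<le> s + e" for u s
      using gap[OF that(1,2)] gap[OF that(2,1)] that(3,4) by (cases u s rule: linorder_cases) auto
    define b where "b = lower_part S a x e"
    have plus_x: "fplus b t = x s" if "s \<in> S" "t < s" "s \<le> t + e" for s t
    proof -
      have "S \<inter> {t<..t + e} \<subseteq> {s}"
      proof
        fix u assume "u \<in> S \<inter> {t<..t + e}"
        then have "u \<in> S" "s \<le> u + e" "u \<le> s + e"
          using that by auto
        then show "u \<in> {s}"
          using uniq[OF ST ST, of u s] that(1) by simp
      qed
      then have "S \<inter> {t<..t + e} = {s}"
        using that by (intro antisym) simp_all
      then show ?thesis
        by (simp add: b_def lower_part_def)
    qed
    have plus_a: "fplus b t = fplus a t" if "S \<inter> {t<..t + e} = {}" for t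
      using that by (simp add: b_def lower_part_def)
    have minus_x: "fminus b t = x s" if "s \<in> S" "t \<le> s" "s < t + e" for s t
    proof -
      have "S \<inter> {t..<t + e} \<subseteq> {s}"
      proof
        fix u assume "u \<in> S \<inter> {t..<t + e}"
        then have "u \<in> S" "s \<le> u + e" "u \<le> s + e"
          using that by auto
        then show "u \<in> {s}"
          using uniq[OF ST ST, of u s] that(1) by simp
      qed
      then have "S \<inter> {t..<t + e} = {s}"
        using that by (intro antisym) simp_all
      then show ?thesis
        by (simp add: b_def lower_part_def)
    qed
    have minus_a: "fminus b t = fminus a t" if "S \<inter> {t..<t + e} = {}" for t
      using that by (simp add: b_def lower_part_def)
    have plus_cases: "(\<exists>s\<in>S. t < s \<and> s \<le> t + e \<and> fplus b t = x s)
        \<or> (S \<inter> {t<..t + e} = {} \<and> fplus b t = fplus a t)" for t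
      using plus_x[of _ t] plus_a[of t] by (cases "S \<inter> {t<..t + e} = {}") auto
    have minus_cases: "(\<exists>s\<in>S. t \<le> s \<and> s < t + e \<and> fminus b t = x s)
        \<or> (S \<inter> {t..<t + e} = {} \<and> fminus b t = fminus a t)" for t
      using minus_x[of _ t] minus_a[of t] by (cases "S \<inter> {t..<t + e} = {}") auto
    note x_ge = A.Lambda_between(1)[OF x] and x_le = A.Lambda_between(2)[OF x]
    \<comment> \<open>The jump of \<open>a\<close> at \<open>s\<close> is split: the part above
      \<open>x s\<close> stays at \<open>s\<close>, the part below moves to
      \<open>s - e\<close>.\<close>
    let ?S' = "S \<union> (\<lambda>s. s - e) ` S"
    interpret B: filtration_jumps ?S' b
    proof
      show "finite ?S'"
        using finS by simp
      fix r t :: real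
      have between: "S \<inter> {s<..<t} = {} \<Longrightarrow> s < t \<Longrightarrow> fplus a s = fminus a t" for s t
        using A.no_jump_between by (simp add: S_def)
      have off: "t \<notin> S \<Longrightarrow> fminus a t = fplus a t" for t
        using A.no_jump by (simp add: S_def)
      show plus_le_minus: "fplus b r \<le> fminus b t" if "r < t"
        using plus_cases[of r]
      proof
        assume "\<exists>p\<in>S. r < p \<and> p \<le> r + e \<and> fplus b r = x p"
        then obtain p where p: "p \<in> S" "r < p" "p \<le> r + e" "fplus b r = x p"
          by blast
        show ?thesis
        proof (cases "p < t")
          case False
          then show ?thesis
            using p minus_x[of p t] that by simp
        next
          case True
          then have "x p \<le> fminus a t"
            using order_trans[OF x_le A.plus_le_minus] by blast
          moreover have "x p \<le> x q" if "t \<le> q" for q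
            using order_trans[OF order_trans[OF x_le A.plus_le_minus] x_ge, of p q] True that by simp
          ultimately show ?thesis
            using minus_cases[of t] p(4) by auto
        qed
      next
        assume *: "S \<inter> {r<..r + e} = {} \<and> fplus b r = fplus a r"
        have "fplus a r \<le> x q" if "t \<le> q" for q
          using order_trans[OF A.plus_le_minus x_ge, of r q] \<open>r < t\<close> that by simp
        then show ?thesis
          using minus_cases[of t] * A.plus_le_minus[OF that] by auto
      qed
      show "fminus b t \<le> fplus b t"
        using minus_cases[of t]
      proof
        assume "\<exists>q\<in>S. t \<le> q \<and> q < t + e \<and> fminus b t = x q"
        then obtain q where q: "q \<in> S" "t \<le> q" "q < t + e" "fminus b t = x q"
          by blast
        show ?thesis
        proof (cases "t = q")
          case True
          have "S \<inter> {t<..t + e} = {}"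
            using gapS[of t] q True by force
          then show ?thesis
            using plus_a[of t] q True x_le[of q] by simp
        next
          case False
          then show ?thesis
            using plus_x[of q t] q by simp
        qed
      next
        assume *: "S \<inter> {t..<t + e} = {} \<and> fminus b t = fminus a t"
        have "fminus a t \<le> x p" if "t < p" for p
          using order_trans[OF A.minus_mono x_ge, of t p] that by simp
        then show ?thesis
          using plus_cases[of t] * A.minus_le_plus[of t] by auto
      qed
      show "fplus b r = fminus b t" if "r < t" and gap': "?S' \<inter> {r<..<t} = {}"
        using plus_cases[of r]
      proof
        assume "\<exists>p\<in>S. r < p \<and> p \<le> r + e \<and> fplus b r = x p"
        then obtain p where p: "p \<in> S" "r < p" "p \<le> r + e" "fplus b r = x p"
          by blast
        then have "t \<le> p"
          using gap' by force
        then show ?thesis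
          using minus_x[of p t] p \<open>r < t\<close> by simp
      next
        assume *: "S \<inter> {r<..r + e} = {} \<and> fplus b r = fplus a r"
        have "S \<inter> {t..<t + e} = {}"
        proof -
          have False if "q \<in> S" "t \<le> q" "q < t + e" for q
          proof -
            have "r + e < q"
              using * that \<open>r < t\<close> by force
            then have "q - e \<in> ?S' \<inter> {r<..<t}"
              using that by auto
            then show False
              using gap' by blast
          qed
          then show ?thesis
            by auto
        qed
        moreover have "S \<inter> {r<..<t} = {}"
          using gap' by blast
        ultimately show ?thesis
          using * minus_a between \<open>r < t\<close> by simp
      qed
      show "fminus b t = fplus b t" if t: "t \<notin> ?S'"
        using plus_cases[of t]
      proof
        assume "\<exists>p\<in>S. t < p \<and> p \<le> t + e \<and> fplus b t = x p"
        then obtain p where p: "p \<in> S" "t < p" "p \<le> t + e" "fplus b t = x p"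
          by blast
        have "t \<noteq> p - e"
          using t p(1) by blast
        then show ?thesis
          using minus_x[of p t] p by simp
      next
        assume *: "S \<inter> {t<..t + e} = {} \<and> fplus b t = fplus a t"
        then have "S \<inter> {t..<t + e} = {}"
          using t by (auto simp: disjoint_iff order_le_less)
        then show ?thesis
          using * minus_a[of t] off t by simp
      qed
      show "fminus b t = lbot" if t: "?S' \<inter> {..<t} = {}"
      proof -
        have "q - e \<notin> {..<t}" if "q \<in> S" for q
          using t that by blast
        then have "S \<inter> {t..<t + e} = {}"
          by force
        moreover have "S \<inter> {..<t} = {}"
          using t by blast
        ultimately show ?thesis
          using minus_a A.no_jump_below by (simp add: S_def)
      qed
      show "fplus b t = ltop" if t: "?S' \<inter> {t<..} = {}"
      proof -
        have "S \<inter> {t<..} = {}"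
          using t by blast
        then have "S \<inter> {t<..} = {}" "S \<inter> {t<..t + e} = {}"
          by auto
        then show ?thesis
          using plus_a A.no_jump_above by (simp add: S_def)
      qed
    qed
    \<comment> \<open>At points of \<open>T\<close> outside \<open>S\<close> the filtration
      \<open>a\<close> does not jump, which forces \<open>x s\<close> to equal its value
      there.\<close>
    have plus_x_T: "fplus b t = x s" if "s \<in> T" "t < s" "s \<le> t + e" for s t
    proof (cases "s \<in> S")
      case False
      have "u \<notin> S" if "t < u" "u \<le> t + e" for u
      proof
        assume u: "u \<in> S"
        then have "u \<in> T" "u \<noteq> s"
          using False by (auto simp: T_def)
        moreover have "s \<le> u + e" "u \<le> s + e"
          using \<open>t < u\<close> \<open>u \<le> t + e\<close> \<open>t < s\<close> \<open>s \<le> t + e\<close> by linarith+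
        ultimately show False
          using uniq \<open>s \<in> T\<close> by blast
      qed
      then have none: "S \<inter> {t<..t + e} = {}"
        by auto
      then have "fplus b t = fplus a t"
        by (rule plus_a)
      also have "\<dots> = fplus a s"
        using none that by (intro A.plus_no_jump_between[symmetric]) (auto simp: S_def)
      also have "\<dots> = x s"
        using False x_ge[of s] x_le[of s] A.no_jump[of s] by (simp add: S_def)
      finally show ?thesis .
    qed (use plus_x that in blast)
    have "complemented_interval (fplus b t) (fplus b (t + 1))" for t
    \<comment> \<open>If a point of \<open>S\<close> lies in \<open>(t, t + e]\<close> or in
      \<open>(t + 1, t + 1 + e]\<close>, then it or its translate by \<open>-1\<close> is such an
      \<open>s\<close>. Otherwise neither end of the window is changed.\<close>
    proof (cases "\<exists>s\<in>T. t < s \<and> s \<le> t + e \<and> s + 1 \<in> T")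
      case True
      then obtain s where "s \<in> T" "s + 1 \<in> T" "t < s" "s \<le> t + e"
        by blast
      then show ?thesis
        using plus_x_T[of s t] plus_x_T[of "s + 1" "t + 1"] A.complemented_Lambda[OF x, of s] by simp
    next
      case False
      have "S \<inter> {t<..t + e} = {}"
        using False by (auto simp: T_def)
      moreover have "S \<inter> {t + 1<..t + 1 + e} = {}"
      proof -
        have "s - 1 \<in> T" "s - 1 + 1 \<in> T" if "s \<in> S" for s
          using that by (auto simp: T_def)
        then show ?thesis
          using False by force
      qed
      ultimately show ?thesis
        using plus_a A.para_plus by simp
    qed
    then have "paracomplemented b"
      by (simp add: paracomplemented_def)
    then have "b \<in> B_filtrations"
      using B.R_filtration by (simp add: B_filtrations_def)
    moreover have "energy b = energy a
      + (\<Sum>t\<in>S. ((t - e)\<^sup>2 - t\<^sup>2) * (v (x t) - v (fminus a t)))"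
    proof -
      have at_s: "fplus b s = fplus a s" "fminus b s = x s"
        and at_s_e: "fplus b (s - e) = x s" "fminus b (s - e) = fminus a s" if s: "s \<in> S" for s
      proof -
        have above: "S \<inter> {s<..s + e} = {}" and below: "S \<inter> {s - e..<s} = {}"
          using gapS[of s] gapS[of _ s] s by force+
        show "fplus b s = fplus a s"
          using above by (rule plus_a)
        show "fminus b s = x s"
          using minus_x s e by simp
        show "fplus b (s - e) = x s"
          using plus_x s e by simp
        have "fminus b (s - e) = fminus a (s - e)"
          using below by (intro minus_a) simp
        also have "\<dots> = fplus a (s - e)"
          using below e by (intro A.no_jump) (auto simp: S_def[symmetric])
        also have "\<dots> = fminus a s"
          using below e by (intro A.no_jump_between) (auto simp: S_def[symmetric])
        finally show "fminus b (s - e) = fminus a s" .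
      qed
      have "S \<inter> (\<lambda>s. s - e) ` S = {}"
        using gapS e(1) by force
      then have "energy b = (\<Sum>t\<in>S. t\<^sup>2 * (v (fplus b t) - v (fminus b t)))
          + (\<Sum>t\<in>(\<lambda>s. s - e) ` S. t\<^sup>2 * (v (fplus b t) - v (fminus b t)))"
        unfolding energy_jumps[OF B.filtration_jumps_axioms] using finS by (intro sum.union_disjoint) auto
      also have "\<dots> = (\<Sum>t\<in>S. t\<^sup>2 * (v (fplus a t) - v (x t)))
          + (\<Sum>t\<in>S. (t - e)\<^sup>2 * (v (x t) - v (fminus a t)))"
        by (subst sum.reindex) (auto simp: inj_on_def at_s at_s_e)
      also have "\<dots> = energy a + (\<Sum>t\<in>S. ((t - e)\<^sup>2 - t\<^sup>2) * (v (x t) - v (fminus a t)))"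
        unfolding energy_def S_def[symmetric] sum.distrib[symmetric]
        by (intro sum.cong refl) (simp add: algebra_simps)
      finally show ?thesis .
    qed
    ultimately show "\<exists>b\<in>B_filtrations. energy b = energy a
      + (\<Sum>t\<in>supp a. ((t - e)\<^sup>2 - t\<^sup>2) * (v (x t) - v (fminus a t)))"
      unfolding S_def by blast
  qed
qed

lemma shift_in_B:
  assumes "para_filtration a"
  shows "\<exists>b\<in>B_filtrations. energy b = (\<Sum>t\<in>supp a. (t + r)\<^sup>2 * (v (fplus a t) - v (fminus a t)))"
proof -
  interpret A: para_filtration a by fact
  let ?b = "(\<lambda>t. fminus a (t - r), \<lambda>t. fplus a (t - r))"
  interpret B: filtration_jumps "(\<lambda>t. t + r) ` supp a" ?b
    by (rule A.jumps_shift)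
  have "paracomplemented ?b"
    using A.para_plus[of "t - r" for t] by (simp add: paracomplemented_def algebra_simps)
  then have "?b \<in> B_filtrations"
    using B.R_filtration by (simp add: B_filtrations_def)
  moreover have "energy ?b = (\<Sum>t\<in>supp a. (t + r)\<^sup>2 * (v (fplus a t) - v (fminus a t)))"
    unfolding energy_jumps[OF B.filtration_jumps_axioms]
    by (subst sum.reindex) (auto simp: inj_on_def)
  ultimately show ?thesis
    by blast
qed

lemma phase_zero_semistable_if_minimal:
  assumes a: "para_filtration a" and min: "\<And>b. b \<in> B_filtrations \<Longrightarrow> energy a \<le> energy b"
  shows "phase_zero_semistable v a"
proof -
  interpret A: para_filtration a by fact
  have le: "(\<Sum>t\<in>supp a. t * (v (x t) - v (fminus a t))) \<le> 0" if x: "x \<in> Lambda a" for x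
  proof -
    obtain e0 where e0: "0 < e0" "\<And>e. 0 < e \<Longrightarrow> e < e0 \<Longrightarrow> \<exists>b\<in>B_filtrations. energy b = energy a
        + (\<Sum>t\<in>supp a. ((t - e)\<^sup>2 - t\<^sup>2) * (v (x t) - v (fminus a t)))"
      using lower_part_in_B[OF a x] by blast
    \<comment> \<open>From \<open>(t - e)^2 - t^2 = e * (e - 2 * t)\<close>, after comparison with
      the lowered filtration and division by \<open>e\<close>.\<close>
    have "2 * (\<Sum>t\<in>supp a. t * (v (x t) - v (fminus a t)))
        \<le> e * (\<Sum>t\<in>supp a. v (x t) - v (fminus a t))" if e: "0 < e" "e < e0" for e
    proof -
      have "0 \<le> (\<Sum>t\<in>supp a. ((t - e)\<^sup>2 - t\<^sup>2) * (v (x t) - v (fminus a t)))"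
        using e0(2)[OF e] min by force
      also have "\<dots> = e * (e * (\<Sum>t\<in>supp a. v (x t) - v (fminus a t))
          - 2 * (\<Sum>t\<in>supp a. t * (v (x t) - v (fminus a t))))"
        unfolding sum_distrib_left right_diff_distrib[of e] sum_subtractf[symmetric]
        by (intro sum.cong refl) (simp add: power2_eq_square algebra_simps)
      finally show ?thesis
        using e(1) by (simp add: zero_le_mult_iff)
    qed
    from nonpos_if_le_small_multiples[OF e0(1) this] show ?thesis
      by simp
  qed
  \<comment> \<open>Lowering along \<open>fplus a\<close> gives the opposite inequality; translating
    all of \<open>a\<close> upwards by \<open>r\<close> gives this one, so the phase is
    zero.\<close>
  moreover have "0 \<le> (\<Sum>t\<in>supp a. t * (v (fplus a t) - v (fminus a t)))"
  proof -
    have "- 2 * (\<Sum>t\<in>supp a. t * (v (fplus a t) - v (fminus a t)))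
        \<le> r * (\<Sum>t\<in>supp a. v (fplus a t) - v (fminus a t))" if r: "0 < r" for r
    proof -
      have "energy a \<le> (\<Sum>t\<in>supp a. (t + r)\<^sup>2 * (v (fplus a t) - v (fminus a t)))"
        using shift_in_B[OF a, of r] min by force
      also have "\<dots> = energy a + r * (r * (\<Sum>t\<in>supp a. v (fplus a t) - v (fminus a t))
          + 2 * (\<Sum>t\<in>supp a. t * (v (fplus a t) - v (fminus a t))))"
        unfolding energy_def sum_distrib_left distrib_left[of r] sum.distrib[symmetric]
        by (intro sum.cong refl) (simp add: power2_eq_square algebra_simps)
      finally show ?thesis
        using r by (simp add: zero_le_mult_iff)
    qed
    from nonpos_if_le_small_multiples[OF zero_less_one this] show ?thesis
      by simp
  qed
  ultimately show ?thesis
    unfolding phase_zero_semistable_def using A.fplus_in_Lambda by (auto intro: antisym)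
qed

end

theorem theorem4p9:
  fixes X :: "(('a::artinian_lattice \<times> 'a) \<Rightarrow>\<^sub>0 int) set \<Rightarrow> real"
  assumes "positive_hom X"
  shows "\<exists>!a. a \<in> B_filtrations \<and>
              semistable (Lambda a) (Z_Lambda X a) \<and>
              lattice_phase (Lambda a) (Z_Lambda X a) = 0"
proof -
  interpret strict_valuation "on_interval X lbot"
    using assms by (rule strict_valuation_on_interval)
  have iff: "a \<in> B_filtrations \<and> semistable (Lambda a) (Z_Lambda X a)
        \<and> lattice_phase (Lambda a) (Z_Lambda X a) = 0
      \<longleftrightarrow> para_filtration a \<and> phase_zero_semistable (on_interval X lbot) a" for a
    using semistable_phase_zero_iff[OF assms] para_filtration_iff by blast
  obtain a :: "'a filtration" where "a \<in> B_filtrations" "\<And>b. b \<in> B_filtrations \<Longrightarrow> energy a \<le> energy b"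
    using energy_attains_min by blast
  then have "para_filtration a \<and> phase_zero_semistable (on_interval X lbot) a"
    using phase_zero_semistable_if_minimal para_filtration_iff by blast
  then show ?thesis
    unfolding iff using phase_zero_unique by blast
qed

end
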